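(* Consider formulas built from literals $p,\overline{p}$ (for propositional variables $p$), the constant $(\leq\! 2)$, conjunction $\wedge$, and the modal operators $\Box$ and $\Diamond$ (no disjunction). The problem of deciding, given such a formula, whether it is satisfiable (true at some world of some Kripke model, over the class of all frames) is PSPACE-hard.
   Context: Models are Kripke models $\langle W,R,\pi\rangle$ with $W$ non-empty, $R\subseteq W\times W$ arbitrary, and $\pi$ assigning to each propositional variable a subset of $W$. Truth: $p$ holds at $w$ iff $w\in\pi(p)$; $\overline{p}$ holds at $w$ iff $w\notin\pi(p)$; $\wedge$ as usual; $\Box\phi$ holds at $w$ iff $\phi$ holds at all $R$-successors of $w$; $\Diamond\phi$ holds at $w$ iff $\phi$ holds at some $R$-successor of $w$; $(\leq\! 2)$ holds at $w$ iff $w$ has at most two $R$-successors. *)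

theory Defs
  imports Main "HOL-Library.Countable_Set" "HOL-Computational_Algebra.Polynomial"
begin

section \<open>Modal formulas without disjunction\<close>

datatype fm =
    Pos nat
  | Neg nat
  | AtMost2
  | And fm fm
  | Box fm
  | Dia fm

definition kripke_model :: "'w set \<Rightarrow> ('w \<times> 'w) set \<Rightarrow> (nat \<Rightarrow> 'w set) \<Rightarrow> bool" where
  "kripke_model W R \<pi> \<longleftrightarrow> W \<noteq> {} \<and> R \<subseteq> W \<times> W \<and> (\<forall>p. \<pi> p \<subseteq> W)"

text \<open>In the clause for \<^const>\<open>AtMost2\<close> finiteness has to be required explicitly, because
  \<^const>\<open>card\<close> is 0 on infinite sets.\<close>

primrec holds :: "('w \<times> 'w) set \<Rightarrow> (nat \<Rightarrow> 'w set) \<Rightarrow> 'w \<Rightarrow> fm \<Rightarrow> bool" where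
  "holds R \<pi> w (Pos p) \<longleftrightarrow> w \<in> \<pi> p"
| "holds R \<pi> w (Neg p) \<longleftrightarrow> w \<notin> \<pi> p"
| "holds R \<pi> w AtMost2 \<longleftrightarrow> finite (R `` {w}) \<and> card (R `` {w}) \<le> 2"
| "holds R \<pi> w (And \<phi> \<psi>) \<longleftrightarrow> holds R \<pi> w \<phi> \<and> holds R \<pi> w \<psi>"
| "holds R \<pi> w (Box \<phi>) \<longleftrightarrow> (\<forall>v. (w, v) \<in> R \<longrightarrow> holds R \<pi> v \<phi>)"
| "holds R \<pi> w (Dia \<phi>) \<longleftrightarrow> (\<exists>v. (w, v) \<in> R \<and> holds R \<pi> v \<phi>)"

text \<open>HOL cannot quantify existentially over types, so the type from which the worlds are drawn
  is a parameter. By \<open>satisfiable_transfer\<close> below, a formula that is satisfiable in any model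
  over any type is satisfiable in a model over each infinite type; hence for an infinite type
  this is satisfiability over the class of all frames.\<close>

definition satisfiable :: "'w itself \<Rightarrow> fm \<Rightarrow> bool" where
  "satisfiable _ \<phi> \<longleftrightarrow>
     (\<exists>(W :: 'w set) R \<pi>. kripke_model W R \<pi> \<and> (\<exists>w\<in>W. holds R \<pi> w \<phi>))"

instance fm :: countable
  by countable_datatype

lemma satisfiable_transfer:
  assumes inf: "infinite (UNIV :: 'w set)"
    and sat: "satisfiable TYPE('v) \<phi>"
  shows "satisfiable TYPE('w) \<phi>"
proof -
  obtain W :: "'v set" and R \<pi> w where M: "kripke_model W R \<pi>" "w \<in> W" "holds R \<pi> w \<phi>"
    using sat unfolding satisfiable_def by blast
  define pick where "pick v \<psi> = (if holds R \<pi> v (Dia \<psi>)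
      then (SOME u. (v, u) \<in> R \<and> holds R \<pi> u \<psi>) else v)" for v \<psi>
  have pick: "(v, pick v \<psi>) \<in> R \<and> holds R \<pi> (pick v \<psi>) \<psi>" if "holds R \<pi> v (Dia \<psi>)" for v \<psi>
    using that someI_ex[of "\<lambda>u. (v, u) \<in> R \<and> holds R \<pi> u \<psi>"] by (simp add: pick_def)
  define V where "V = range (foldl pick w)"
  have V_pick: "pick v \<psi> \<in> V" if "v \<in> V" for v \<psi>
  proof -
    from that obtain \<psi>s where "v = foldl pick w \<psi>s" by (auto simp: V_def)
    then have "pick v \<psi> = foldl pick w (\<psi>s @ [\<psi>])" by simp
    then show ?thesis unfolding V_def by blast
  qed
  have "w = foldl pick w []" by simp
  then have w_V: "w \<in> V" unfolding V_def by blast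
  have "countable V" unfolding V_def by simp
  then obtain g :: "'v \<Rightarrow> nat" where g: "inj_on g V" by (auto simp: countable_def)
  obtain h :: "nat \<Rightarrow> 'w" where h: "inj h" using infinite_countable_subset[OF inf] by blast
  define e where "e = h \<circ> g"
  have e: "inj_on e V" unfolding e_def using g h by (meson comp_inj_on inj_on_subset subset_UNIV)
  define R' where "R' = {(e u, e v) |u v. u \<in> V \<and> v \<in> V \<and> (u, v) \<in> R}"
  define \<pi>' where "\<pi>' p = e ` (\<pi> p \<inter> V)" for p
  have succ: "R' `` {e v} = e ` (R `` {v} \<inter> V)" if "v \<in> V" for v
    using that e unfolding R'_def by (auto dest: inj_onD)
  have pres: "holds R' \<pi>' (e v) \<psi>" if "v \<in> V" "holds R \<pi> v \<psi>" for v \<psi>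
    using that
  proof (induction \<psi> arbitrary: v)
    case (Neg p)
    then show ?case using e by (auto simp: \<pi>'_def dest: inj_onD)
  next
    case AtMost2
    have "card (e ` (R `` {v} \<inter> V)) \<le> card (R `` {v} \<inter> V)"
      using AtMost2 by (intro card_image_le) auto
    also have "\<dots> \<le> card (R `` {v})"
      using AtMost2 by (intro card_mono) auto
    finally show ?case using AtMost2 by (simp add: succ)
  next
    case (Box \<psi>)
    have "holds R' \<pi>' u \<psi>" if "(e v, u) \<in> R'" for u
    proof -
      have "u \<in> e ` (R `` {v} \<inter> V)" using that succ[OF \<open>v \<in> V\<close>] by blast
      then show ?thesis using Box by auto
    qed
    then show ?case by simp
  next
    case (Dia \<psi>)
    have "(e v, e (pick v \<psi>)) \<in> R'"
      using pick[OF Dia.prems(2)] V_pick Dia.prems(1) unfolding R'_def by blast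
    moreover have "holds R' \<pi>' (e (pick v \<psi>)) \<psi>"
      using pick[OF Dia.prems(2)] V_pick[OF Dia.prems(1)] Dia.IH by blast
    ultimately show ?case by auto
  qed (auto simp: \<pi>'_def)
  have "kripke_model (e ` V) R' \<pi>'"
    using w_V by (auto simp: kripke_model_def R'_def \<pi>'_def)
  then show ?thesis
    unfolding satisfiable_def using pres[OF w_V M(3)] w_V by blast
qed


section \<open>Formulas as binary strings\<close>

text \<open>Formulas are written in prefix notation with a three-bit tag per constructor. Variable
  indices are written in binary, least significant digit first, each digit preceded by
  \<^const>\<open>True\<close> and the whole numeral closed by \<^const>\<open>False\<close>.\<close>

fun enc_nat :: "nat \<Rightarrow> bool list" where
  "enc_nat n = (if n = 0 then [False] else True # odd n # enc_nat (n div 2))"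

declare enc_nat.simps [simp del]

primrec enc_fm :: "fm \<Rightarrow> bool list" where
  "enc_fm (Pos p) = [False, False, False] @ enc_nat p"
| "enc_fm (Neg p) = [False, False, True] @ enc_nat p"
| "enc_fm AtMost2 = [False, True, False]"
| "enc_fm (And \<phi> \<psi>) = [False, True, True] @ enc_fm \<phi> @ enc_fm \<psi>"
| "enc_fm (Box \<phi>) = [True, False, False] @ enc_fm \<phi>"
| "enc_fm (Dia \<phi>) = [True, False, True] @ enc_fm \<phi>"

lemma enc_nat_append_inject: "enc_nat m @ xs = enc_nat n @ ys \<longleftrightarrow> m = n \<and> xs = ys"
proof (induction m arbitrary: n rule: enc_nat.induct)
  case (1 m)
  show ?case
  proof (cases "m = 0 \<or> n = 0")
    case True
    then show ?thesis
      by (cases "m = 0"; cases "n = 0") (simp_all add: enc_nat.simps[of 0] enc_nat.simps[of m] enc_nat.simps[of n])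
  next
    case False
    have "m = n \<longleftrightarrow> odd m = odd n \<and> m div 2 = n div 2"
      by (metis even_two_times_div_two odd_two_times_div_two_succ)
    then show ?thesis
      using False 1 by (auto simp: enc_nat.simps[of m] enc_nat.simps[of n])
  qed
qed

lemma enc_fm_append_inject: "enc_fm \<phi> @ xs = enc_fm \<psi> @ ys \<longleftrightarrow> \<phi> = \<psi> \<and> xs = ys"
proof (induction \<phi> arbitrary: \<psi> xs ys)
  case (Pos p) then show ?case by (cases \<psi>) (auto simp: enc_nat_append_inject)
next
  case (Neg p) then show ?case by (cases \<psi>) (auto simp: enc_nat_append_inject)
next
  case AtMost2 then show ?case by (cases \<psi>) auto
next
  case (And \<phi>1 \<phi>2) then show ?case by (cases \<psi>) auto
next
  case (Box \<phi>) then show ?case by (cases \<psi>) auto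
next
  case (Dia \<phi>) then show ?case by (cases \<psi>) auto
qed

lemma inj_enc_fm: "inj enc_fm"
  using enc_fm_append_inject[of _ "[]" _ "[]"] by (auto intro: injI)

definition SAT :: "'w itself \<Rightarrow> bool list set" where
  "SAT T = {enc_fm \<phi> |\<phi>. satisfiable T \<phi>}"


section \<open>Deterministic multi-tape Turing machines\<close>

text \<open>Tape symbols are natural numbers: 0 is the blank, 1 marks the left end of a tape
  initially, 2 and 3 stand for the two input bits, and further symbols may be used as work
  symbols. A tape is a function from cell numbers to symbols together with a head position;
  tapes are infinite to the right only, and a head on cell 0 that is told to move left stays
  there (truncated subtraction).

  A machine is the list of its transition functions, one for each non-halting state; the state
  0 is the start state, and the number \<^term>\<open>length M\<close> is the unique halting state.\<close>

datatype move = MoveLeft | Stay | MoveRight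

type_synonym tape = "(nat \<Rightarrow> nat) \<times> nat"
type_synonym machine = "(nat list \<Rightarrow> nat \<times> (nat \<times> move) list) list"
type_synonym config = "nat \<times> tape list"

text \<open>\<open>turing_machine k G M\<close>: \<open>M\<close> works on \<open>k\<close> tapes with the finite alphabet \<open>{..<G}\<close>. Only the
  behaviour of the transition functions on \<open>k\<close>-tuples over this alphabet matters.\<close>

definition turing_machine :: "nat \<Rightarrow> nat \<Rightarrow> machine \<Rightarrow> bool" where
  "turing_machine k G M \<longleftrightarrow> k \<ge> 1 \<and> G \<ge> 4 \<and>
     (\<forall>\<delta> \<in> set M. \<forall>gs. length gs = k \<and> set gs \<subseteq> {..<G} \<longrightarrow>
        fst (\<delta> gs) \<le> length M \<and>
        length (snd (\<delta> gs)) = k \<and>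
        fst ` set (snd (\<delta> gs)) \<subseteq> {..<G})"

fun read :: "tape \<Rightarrow> nat" where
  "read (c, i) = c i"

fun move_head :: "move \<Rightarrow> nat \<Rightarrow> nat" where
  "move_head MoveLeft i = i - 1"
| "move_head Stay i = i"
| "move_head MoveRight i = i + 1"

fun act :: "nat \<times> move \<Rightarrow> tape \<Rightarrow> tape" where
  "act (g, m) (c, i) = (c(i := g), move_head m i)"

fun step :: "machine \<Rightarrow> config \<Rightarrow> config" where
  "step M (q, tps) =
     (if q < length M
      then let (q', acts) = (M ! q) (map read tps) in (q', map2 act acts tps)
      else (q, tps))"

fun bit_symbol :: "bool \<Rightarrow> nat" where
  "bit_symbol False = 2"
| "bit_symbol True = 3"

definition tape_of :: "bool list \<Rightarrow> tape" where
  "tape_of x = ((\<lambda>i. if i = 0 then 1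
                     else if i \<le> length x then bit_symbol (x ! (i - 1))
                     else 0), 0)"

text \<open>The input is given on the first tape; all other tapes are empty.\<close>

definition init :: "nat \<Rightarrow> bool list \<Rightarrow> config" where
  "init k x = (0, tape_of x # replicate (k - 1) (tape_of []))"

definition run :: "machine \<Rightarrow> nat \<Rightarrow> bool list \<Rightarrow> nat \<Rightarrow> config" where
  "run M k x t = (step M ^^ t) (init k x)"

text \<open>The output is read from the last tape, starting at cell 1 and ending before the first
  blank.\<close>

definition halts_with_output :: "machine \<Rightarrow> config \<Rightarrow> bool list \<Rightarrow> bool" where
  "halts_with_output M cfg y \<longleftrightarrow>
     fst cfg = length M \<and>
     (\<forall>i < length y. fst (last (snd cfg)) (Suc i) = bit_symbol (y ! i)) \<and>
     fst (last (snd cfg)) (Suc (length y)) = 0"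


section \<open>PSPACE-hardness\<close>

definition polytime_computable :: "(bool list \<Rightarrow> bool list) \<Rightarrow> bool" where
  "polytime_computable f \<longleftrightarrow>
     (\<exists>k G M (p :: nat poly). turing_machine k G M \<and>
        (\<forall>x. \<exists>t \<le> poly p (length x). halts_with_output M (run M k x t) (f x)))"

text \<open>The space used is measured by the head positions on all tapes, including the input
  tape.\<close>

definition PSPACE :: "bool list set set" where
  "PSPACE = {L. \<exists>k G M (p :: nat poly). turing_machine k G M \<and>
     (\<forall>x. (\<exists>t. halts_with_output M (run M k x t) [x \<in> L]) \<and>
          (\<forall>t. \<forall>tp \<in> set (snd (run M k x t)). snd tp \<le> poly p (length x)))}"

definition polytime_reducible :: "bool list set \<Rightarrow> bool list set \<Rightarrow> bool"  (infix "\<le>\<^sub>p" 50) where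
  "L \<le>\<^sub>p L' \<longleftrightarrow> (\<exists>f. polytime_computable f \<and> (\<forall>x. x \<in> L \<longleftrightarrow> f x \<in> L'))"

definition PSPACE_hard :: "bool list set \<Rightarrow> bool" where
  "PSPACE_hard L' \<longleftrightarrow> (\<forall>L \<in> PSPACE. L \<le>\<^sub>p L')"

end

(* In a world with at most two successors, of which one satisfies q and the other does not, a further
   diamond is a choice between the two: this gives existential and universal choices. A choice constrains
   the worlds below it by formulas Box^d (Dia A), where A is one of three pairwise incompatible marks.
   A world at depth d that has at most two successors then refutes the simultaneous presence of all
   three marks, so every constraint that rules out a combination of at most three choices can be
   expressed without disjunction, provided that the depth of the worlds where it is checked is known.

   Such constraints suffice for Savitch's recursion. A configuration of a space bounded machine is a word
   over a finite alphabet whose evolution is governed by binary constraints between neighbouring cells and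
   between a cell and its successor. To reach Y from X in 2^(m+1) steps one chooses Z, lets the opponent
   choose a half, and goes on with (X, Z) or (Z, Y); that the next pair has been copied correctly is a
   condition on the bit, a symbol of the old block and a symbol of the new block.

   In prefix notation the resulting formula consists of fixed words repeated in nested loops, apart from
   the initial configuration, which follows the input. A Turing machine prints it with one tape per loop. *)

theory Submission
  imports Defs
begin

section \<open>Pending marks\<close>

text \<open>The alphabet of cells, and with it the number of checks in a chunk and of alternatives
  in a choice, depends only on the machine that decides the language. The input affects only how
  often chunks are repeated and which symbols the first block admits, so loops can print the
  formula. The obstacle is that a choice cannot test where a constraint becomes relevant; it can
  only place demands at fixed distances. Hence every chunk, even that of a single bit, is padded to
  one common depth, and each forbidden combination owns a check level at which the choices involved
  deliver their marks. Demands must fall on check levels only, because the levels at which a symbol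
  is chosen are themselves limited to two successors. As frames are arbitrary, soundness follows
  paths and keeps a schedule of the marks still due; completeness builds finite trees in which the
  branches off the play avoid variable 3. Variable 0 carries the choices, 2 stands for truth, 3
  marks the play, and 4 and 5 encode the marks.\<close>

definition mark :: "nat \<Rightarrow> fm" where
  "mark i = (if i = 0 then And (Pos 4) (Pos 5) else if i = 1 then And (Pos 4) (Neg 5) else Neg 4)"

text \<open>Every world at distance \<open>d\<close> must have successors with the marks in \<open>P d\<close>.\<close>

definition pending :: "('w \<times> 'w) set \<Rightarrow> (nat \<Rightarrow> 'w set) \<Rightarrow> 'w \<Rightarrow> (nat \<Rightarrow> nat set) \<Rightarrow> bool" where
  "pending R \<pi> w P \<longleftrightarrow> (\<forall>d. \<forall>i \<in> P d. holds R \<pi> w ((Box ^^ d) (Dia (mark i))))"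

text \<open>A schedule whose depths are counted from a later world, re-read from a world
  \<open>n\<close> levels above it.\<close>

definition delay :: "nat \<Rightarrow> (nat \<Rightarrow> nat set) \<Rightarrow> nat \<Rightarrow> nat set" where
  "delay n P d = (if d < n then {} else P (d - n))"

lemma delay_less: "d < n \<Longrightarrow> delay n P d = {}"
  and delay_add: "delay n P (d + n) = P d"
  by (auto simp: delay_def)

lemma delay_0 [simp]: "delay 0 P = P"
  by (auto simp: delay_def)

lemma delay_Suc: "delay (Suc n) P 0 = {}" "(\<lambda>d. delay (Suc n) P (Suc d)) = delay n P"
  by (auto simp: delay_def fun_eq_iff)

lemma pending_unfold:
  "pending R \<pi> w P \<longleftrightarrow> (\<forall>i \<in> P 0. \<exists>v. (w, v) \<in> R \<and> holds R \<pi> v (mark i)) \<and>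
     (\<forall>v. (w, v) \<in> R \<longrightarrow> pending R \<pi> v (\<lambda>d. P (Suc d)))"
  unfolding pending_def
proof (intro iffI conjI allI ballI impI, goal_cases)
  case (1 i) then show ?case by (auto dest!: spec[of _ 0])
next
  case (2 v d i) then show ?case by (auto dest!: spec[of _ "Suc d"])
next
  case (3 d i) then show ?case by (cases d) auto
qed

lemma pending_Un: "pending R \<pi> w (\<lambda>d. P d \<union> Q d) \<longleftrightarrow> pending R \<pi> w P \<and> pending R \<pi> w Q"
  unfolding pending_def by blast

text \<open>The hole is the last subformula, so in prefix notation this is a fixed word in front of
  the code of \<open>\<phi>\<close>; the printing lemmas rely on that.\<close>

definition info_ctx :: "nat list \<Rightarrow> fm \<Rightarrow> fm" where
  "info_ctx S \<phi> = foldr (\<lambda>i. And (Dia (mark i))) S (Box \<phi>)"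

text \<open>The language has no tautology; variable 2 is meant to be true everywhere.\<close>

definition info :: "nat list list \<Rightarrow> fm" where
  "info I = foldr info_ctx I (Pos 2)"

definition marks :: "nat list list \<Rightarrow> nat \<Rightarrow> nat set" where
  "marks I d = (if d < length I then set (I ! d) else {})"

lemma marks_Nil: "marks [] d = {}"
  and marks_Cons: "marks (S # I) 0 = set S" "(\<lambda>d. marks (S # I) (Suc d)) = marks I"
  by (auto simp: marks_def fun_eq_iff)

lemma holds_info_ctx:
  "holds R \<pi> w (info_ctx S \<phi>) \<longleftrightarrow>
     (\<forall>i \<in> set S. \<exists>v. (w, v) \<in> R \<and> holds R \<pi> v (mark i)) \<and> (\<forall>v. (w, v) \<in> R \<longrightarrow> holds R \<pi> v \<phi>)"
proof -
  have "holds R \<pi> w (foldr (\<lambda>i. And (Dia (mark i))) S \<psi>) \<longleftrightarrow>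
     (\<forall>i \<in> set S. \<exists>v. (w, v) \<in> R \<and> holds R \<pi> v (mark i)) \<and> holds R \<pi> w \<psi>" for \<psi>
    by (induction S) auto
  then show ?thesis unfolding info_ctx_def by simp
qed

lemma info_pending: "holds R \<pi> w (info I) \<Longrightarrow> pending R \<pi> w (marks I)"
proof (induction I arbitrary: w)
  case Nil
  then show ?case by (simp add: pending_def marks_Nil)
next
  case (Cons S I)
  then show ?case
    by (subst pending_unfold) (auto simp: info_def marks_Cons holds_info_ctx)
qed

lemma Box_info_pending:
  "holds R \<pi> w ((Box ^^ n) (And \<phi> (info I))) \<Longrightarrow> pending R \<pi> w (delay n (marks I))"
proof (induction n arbitrary: w)
  case 0
  then show ?case by (simp add: info_pending)
next
  case (Suc n)
  then show ?case
    by (subst pending_unfold) (auto simp: delay_Suc)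
qed

section \<open>Choices and checks\<close>

definition check :: "fm \<Rightarrow> fm" where
  "check \<phi> = And AtMost2 (Dia \<phi>)"

text \<open>Variable 0 separates the two successors of a choice. Variable 3 holds where the play goes on
  after a choice; the leaf of a symbol that is not allowed denies it.\<close>

primrec comb :: "(nat \<Rightarrow> fm) \<Rightarrow> nat list \<Rightarrow> fm" where
  "comb f [] = Neg 3"
| "comb f (a # as) = And AtMost2 (And (Dia (And (Pos 0) ((Box ^^ length as) (f a))))
     (Dia (And (Neg 0) (comb f as))))"

definition leaf :: "(nat \<Rightarrow> bool) \<Rightarrow> (nat \<Rightarrow> nat list list) \<Rightarrow> nat \<Rightarrow> fm" where
  "leaf al I a = And (if al a then Pos 2 else Neg 3) (info (I a))"

section \<open>Soundness: reading choices and checks off an arbitrary model\<close>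

lemma marks_incompatible:
  assumes "holds R \<pi> u (mark i)" "holds R \<pi> u (mark j)" "i < 3" "j < 3"
  shows "i = j"
  using assms by (auto simp: mark_def split: if_splits)

lemma checkD:
  assumes "holds R \<pi> w (check \<phi>)" "pending R \<pi> w P"
  shows "\<not> {..<3} \<subseteq> P 0" "\<exists>v. holds R \<pi> v \<phi> \<and> pending R \<pi> v (\<lambda>d. P (Suc d))"
proof -
  show "\<not> {..<3} \<subseteq> P 0"
  proof
    assume "{..<3} \<subseteq> P 0"
    then have "\<forall>i \<in> {..<3}. \<exists>v. (w, v) \<in> R \<and> holds R \<pi> v (mark i)"
      using assms(2) by (subst (asm) pending_unfold) blast
    then obtain f where f: "\<forall>i \<in> {..<3}. (w, f i) \<in> R \<and> holds R \<pi> (f i) (mark i)"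
      by metis
    have "inj_on f {..<3}"
      using f marks_incompatible[of R \<pi>] by (intro inj_onI) (metis lessThan_iff)
    then have "3 = card (f ` {..<3})"
      by (simp add: card_image)
    also have "\<dots> \<le> card (R `` {w})"
      using assms(1) f by (intro card_mono) (auto simp: check_def)
    finally show False using assms(1) by (simp add: check_def)
  qed
  show "\<exists>v. holds R \<pi> v \<phi> \<and> pending R \<pi> v (\<lambda>d. P (Suc d))"
    using assms by (subst (asm) pending_unfold) (auto simp: check_def)
qed

lemma checksD:
  assumes "holds R \<pi> w ((check ^^ n) \<phi>)" "pending R \<pi> w P"
  shows "(\<forall>k<n. \<not> {..<3} \<subseteq> P k) \<and> (\<exists>v. holds R \<pi> v \<phi> \<and> pending R \<pi> v (\<lambda>d. P (d + n)))"
  using assms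
proof (induction n arbitrary: w P)
  case 0
  then show ?case by auto
next
  case (Suc n)
  have *: "holds R \<pi> w (check ((check ^^ n) \<phi>))" using Suc.prems by simp
  obtain v where "holds R \<pi> v ((check ^^ n) \<phi>)" "pending R \<pi> v (\<lambda>d. P (Suc d))"
    using checkD(2)[OF * Suc.prems(2)] by blast
  from Suc.IH[OF this] checkD(1)[OF * Suc.prems(2)] show ?case
    by (auto simp: less_Suc_eq_0_disj)
qed

lemma DiasD:
  assumes "holds R \<pi> w ((Dia ^^ n) \<phi>)" "pending R \<pi> w P"
  shows "\<exists>v. holds R \<pi> v \<phi> \<and> pending R \<pi> v (\<lambda>d. P (d + n))"
  using assms
proof (induction n arbitrary: w P)
  case (Suc n)
  then obtain v where "(w, v) \<in> R" "holds R \<pi> v ((Dia ^^ n) \<phi>)" by auto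
  moreover have "pending R \<pi> v (\<lambda>d. P (Suc d))"
    using Suc.prems calculation by (subst (asm) pending_unfold) auto
  ultimately show ?case using Suc.IH[of v "\<lambda>d. P (Suc d)"] by simp
qed auto

lemma two_successors:
  assumes "finite (R `` {w})" "card (R `` {w}) \<le> 2" "(w, u) \<in> R" "(w, v) \<in> R" "(w, z) \<in> R" "u \<noteq> v"
  shows "z = u \<or> z = v"
proof (rule ccontr)
  assume "\<not> (z = u \<or> z = v)"
  then have "card {u, v, z} = 3" using assms(6) by auto
  moreover have "card {u, v, z} \<le> card (R `` {w})" using assms by (intro card_mono) auto
  ultimately show False using assms(2) by simp
qed

text \<open>Follow the path of diamonds. At each level the bound on successors together with
  variable 0 leaves two worlds, so the path enters either the branch of \<open>a\<close> or the rest
  of the comb. It cannot run to the end of the comb, where variable 3 is false, so it leaves at some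
  symbol.\<close>

lemma combD:
  assumes "holds R \<pi> w (comb (leaf al I) as)" "holds R \<pi> w ((Dia ^^ length as) (And (Pos 3) \<phi>))"
    "pending R \<pi> w P"
  shows "\<exists>a \<in> set as. al a \<and>
    (\<exists>v. holds R \<pi> v \<phi> \<and> pending R \<pi> v (\<lambda>d. P (d + length as) \<union> marks (I a) d))"
  using assms
proof (induction as arbitrary: w P)
  case (Cons a as)
  let ?\<psi> = "(Dia ^^ length as) (And (Pos 3) \<phi>)"
  obtain v where v: "(w, v) \<in> R" "holds R \<pi> v ?\<psi>" using Cons.prems by auto
  obtain x where x: "(w, x) \<in> R" "x \<in> \<pi> 0" "holds R \<pi> x ((Box ^^ length as) (leaf al I a))"
    using Cons.prems by auto
  obtain y where y: "(w, y) \<in> R" "y \<notin> \<pi> 0" "holds R \<pi> y (comb (leaf al I) as)"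
    using Cons.prems by auto
  have P: "pending R \<pi> v (\<lambda>d. P (Suc d))"
    using Cons.prems(3) v(1) by (subst (asm) pending_unfold) auto
  have "v = x \<or> v = y"
    using two_successors[of R w x y v] Cons.prems(1) v(1) x y by auto
  then show ?case
  proof
    assume "v = y"
    then show ?thesis using Cons.IH[of y "\<lambda>d. P (Suc d)"] v y P by auto
  next
    assume vx: "v = x"
    have "pending R \<pi> v (delay (length as) (marks (I a)))"
      using x(3) unfolding vx leaf_def by (rule Box_info_pending)
    then have Q: "pending R \<pi> v (\<lambda>d. P (Suc d) \<union> delay (length as) (marks (I a)) d)"
      using P by (simp add: pending_Un)
    obtain u where u: "holds R \<pi> u (And (Pos 3) \<phi>)"
      "pending R \<pi> u (\<lambda>d. P (Suc (d + length as)) \<union> delay (length as) (marks (I a)) (d + length as))"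
      using DiasD[OF v(2) Q] by auto
    \<comment> \<open>A leaf that is not allowed makes variable 3 false at the very depth where the
      path needs it true.\<close>
    have "al a"
    proof (rule ccontr)
      assume "\<not> al a"
      then have "holds R \<pi> v ((Box ^^ length as) (And (Neg 3) (info (I a))))"
        using x(3) vx by (simp add: leaf_def)
      moreover have "\<not> (holds R \<pi> v ((Box ^^ n) (And (Neg 3) \<chi>)) \<and> holds R \<pi> v ((Dia ^^ n) (And (Pos 3) \<phi>)))"
        for n \<chi> by (induction n arbitrary: v) auto
      ultimately show False using v(2) by blast
    qed
    then show ?thesis using u by (auto simp: delay_def)
  qed
qed auto

section \<open>Building tree models\<close>

text \<open>All finite trees together form one fixed model. Truth at a tree depends on that tree
  alone, so subtrees can be built separately and assembled.\<close>

datatype tree = Node "nat set" "tree list"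

definition child :: "(tree \<times> tree) set" where
  "child = {(Node V ts, t) | V ts t. t \<in> set ts}"

definition label :: "nat \<Rightarrow> tree set" where
  "label p = {Node V ts | V ts. p \<in> V}"

abbreviation sat :: "tree \<Rightarrow> fm \<Rightarrow> bool" where
  "sat \<equiv> holds child label"

lemma child_iff [simp]: "(Node V ts, t) \<in> child \<longleftrightarrow> t \<in> set ts"
  by (auto simp: child_def)

lemma children [simp]: "child `` {Node V ts} = set ts"
  by auto

lemma label_iff [simp]: "Node V ts \<in> label p \<longleftrightarrow> p \<in> V"
  by (auto simp: label_def)

definition everywhere :: "nat \<Rightarrow> tree \<Rightarrow> bool" where
  "everywhere p t \<longleftrightarrow> (\<forall>d. sat t ((Box ^^ d) (Pos p)))"

definition nowhere :: "nat \<Rightarrow> tree \<Rightarrow> bool" where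
  "nowhere p t \<longleftrightarrow> (\<forall>d. sat t ((Box ^^ d) (Neg p)))"

lemma hereditary_Node:
  "(\<forall>d. sat (Node V ts) ((Box ^^ d) \<phi>)) \<longleftrightarrow>
     sat (Node V ts) \<phi> \<and> (\<forall>t \<in> set ts. \<forall>d. sat t ((Box ^^ d) \<phi>))"
proof (intro iffI conjI ballI allI, goal_cases)
  case 1 then show ?case by (auto dest: spec[of _ 0])
next
  case (2 t d) then show ?case by (auto dest: spec[of _ "Suc d"])
next
  case (3 d) then show ?case by (cases d) auto
qed

lemma everywhere_Node: "everywhere p (Node V ts) \<longleftrightarrow> p \<in> V \<and> (\<forall>t \<in> set ts. everywhere p t)"
  unfolding everywhere_def by (subst hereditary_Node) simp

lemma nowhere_Node: "nowhere p (Node V ts) \<longleftrightarrow> p \<notin> V \<and> (\<forall>t \<in> set ts. nowhere p t)"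
  unfolding nowhere_def by (subst hereditary_Node) simp

lemma pending_Node:
  "pending child label (Node V ts) P \<longleftrightarrow> (\<forall>i \<in> P 0. \<exists>t \<in> set ts. sat t (mark i)) \<and>
     (\<forall>t \<in> set ts. pending child label t (\<lambda>d. P (Suc d)))"
  by (subst pending_unfold) auto

lemma info_sat:
  assumes "pending child label t (marks I)" "everywhere 2 t"
  shows "sat t (info I)"
  using assms
proof (induction I arbitrary: t)
  case Nil
  then show ?case by (cases t) (simp add: info_def everywhere_Node)
next
  case (Cons S I)
  obtain V ts where t: "t = Node V ts" by (cases t)
  have "sat u (info I)" if "u \<in> set ts" for u
    using Cons.IH[of u] Cons.prems that by (auto simp: t pending_Node marks_Cons everywhere_Node)
  then show ?case
    using Cons.prems by (auto simp: t info_def holds_info_ctx pending_Node marks_Cons)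
qed

text \<open>Leaves of symbols that are not chosen have to hold as well; where the symbol is not
  allowed, this is achieved by keeping variable 3 false throughout the branch.\<close>

lemma Box_leaf_sat:
  assumes "pending child label t (delay n (marks (I a)))" "everywhere 2 t" "al a \<or> nowhere 3 t"
  shows "sat t ((Box ^^ n) (leaf al I a))"
  using assms
proof (induction n arbitrary: t)
  case 0
  then show ?case
    using info_sat[of t "I a"] by (cases t) (auto simp: leaf_def everywhere_Node nowhere_Node)
next
  case (Suc n)
  obtain V ts where t: "t = Node V ts" by (cases t)
  have "sat u ((Box ^^ n) (leaf al I a))" if "u \<in> set ts" for u
    using Suc.IH[of u] Suc.prems that
    by (auto simp: t pending_Node delay_Suc everywhere_Node nowhere_Node)
  then show ?case by (simp add: t)
qed

section \<open>Finite schedules and branches off the play\<close>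

definition bounded_marks :: "(nat \<Rightarrow> nat set) \<Rightarrow> bool" where
  "bounded_marks P \<longleftrightarrow> (\<forall>d. P d \<subseteq> {..<3}) \<and> (\<exists>n. \<forall>d\<ge>n. P d = {})"

lemma bounded_marks_shift: "bounded_marks P \<Longrightarrow> bounded_marks (\<lambda>d. P (d + n))"
  unfolding bounded_marks_def by (meson trans_le_add1)

lemma bounded_marks_Suc: "bounded_marks P \<Longrightarrow> bounded_marks (\<lambda>d. P (Suc d))"
  using bounded_marks_shift[of P 1] by simp

lemma bounded_marks_Un:
  assumes "bounded_marks P" "bounded_marks Q"
  shows "bounded_marks (\<lambda>d. P d \<union> Q d)"
proof -
  obtain m n where "\<forall>d\<ge>m. P d = {}" "\<forall>d\<ge>n. Q d = {}"
    using assms unfolding bounded_marks_def by blast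
  then have "\<forall>d\<ge>max m n. P d \<union> Q d = {}" by simp
  then show ?thesis using assms unfolding bounded_marks_def by blast
qed

lemma bounded_marks_delay:
  assumes "bounded_marks P"
  shows "bounded_marks (delay n P)"
proof -
  obtain m where "\<forall>d\<ge>m. P d = {}" using assms unfolding bounded_marks_def by blast
  then have "\<forall>d\<ge>m + n. delay n P d = {}" by (simp add: delay_def)
  then show ?thesis using assms unfolding bounded_marks_def delay_def by force
qed

lemma bounded_marks_marks:
  assumes "\<forall>S \<in> set I. set S \<subseteq> {..<3}"
  shows "bounded_marks (marks I)"
  unfolding bounded_marks_def marks_def using assms
  by (auto intro!: exI[of _ "length I"] dest: nth_mem)

definition mark_label :: "nat \<Rightarrow> nat set" where
  "mark_label i = (if i = 0 then {4, 5} else if i = 1 then {4} else {})"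

lemma mark_label: "5 \<notin> V \<Longrightarrow> 4 \<notin> V \<Longrightarrow> sat (Node (V \<union> mark_label i) ts) (mark i)"
  by (auto simp: mark_def mark_label_def)

text \<open>Away from the play nothing limits the branching, so all pending marks can be realised.\<close>

lemma free_tree:
  assumes "bounded_marks P" "2 \<in> V" "3 \<notin> V"
  shows "\<exists>ts. pending child label (Node V ts) P \<and> everywhere 2 (Node V ts) \<and> nowhere 3 (Node V ts)"
proof -
  obtain n where "\<forall>d\<ge>n. P d = {}" using assms unfolding bounded_marks_def by blast
  then show ?thesis using assms
  proof (induction n arbitrary: P V)
    case 0
    then show ?case
      by (auto simp: pending_def everywhere_Node nowhere_Node intro!: exI[of _ "[]"])
  next
    case (Suc n)
    define u where "u i = (SOME ts. pending child label (Node ({2} \<union> mark_label i) ts) (\<lambda>d. P (Suc d)) \<and>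
       everywhere 2 (Node ({2} \<union> mark_label i) ts) \<and> nowhere 3 (Node ({2} \<union> mark_label i) ts))" for i
    have "\<exists>ts. pending child label (Node ({2} \<union> mark_label i) ts) (\<lambda>d. P (Suc d)) \<and>
       everywhere 2 (Node ({2} \<union> mark_label i) ts) \<and> nowhere 3 (Node ({2} \<union> mark_label i) ts)" for i
      using Suc.prems
      by (intro Suc.IH bounded_marks_Suc) (auto simp: mark_label_def split: if_splits)
    from someI_ex[OF this] have u: "pending child label (Node ({2} \<union> mark_label i) (u i)) (\<lambda>d. P (Suc d))"
      "everywhere 2 (Node ({2} \<union> mark_label i) (u i))" "nowhere 3 (Node ({2} \<union> mark_label i) (u i))" for i
      unfolding u_def by blast+
    let ?ts = "map (\<lambda>i. Node ({2} \<union> mark_label i) (u i)) (filter (\<lambda>i. i \<in> P 0) [0..<3])"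
    have sub: "P 0 \<subseteq> {..<3}" using Suc.prems unfolding bounded_marks_def by blast
    have "pending child label (Node V ?ts) P"
      unfolding pending_Node
    proof (intro conjI ballI)
      fix i assume "i \<in> P 0"
      then show "\<exists>t \<in> set ?ts. sat t (mark i)"
        using sub mark_label[of "{2}" i "u i"] by (intro bexI[of _ "Node ({2} \<union> mark_label i) (u i)"]) auto
    qed (use u in auto)
    then show ?case
      using Suc.prems u by (intro exI[of _ ?ts]) (auto simp: everywhere_Node nowhere_Node)
  qed
qed
text \<open>Once the play has left a comb, the remaining alternatives still need a model. Each of
  their choice worlds gets just the two successors it asks for, neither built to carry a mark; hence
  no mark may fall due above the leaves.\<close>

lemma off_comb:
  assumes "bounded_marks P" "\<And>d. d < length as \<Longrightarrow> P d = {}" "2 \<in> V" "3 \<notin> V"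
    "\<And>a. a \<in> set as \<Longrightarrow> bounded_marks (marks (I a))"
  shows "\<exists>ts. pending child label (Node V ts) P \<and> everywhere 2 (Node V ts) \<and> sat (Node V ts) (comb (leaf al I) as)"
  using assms
proof (induction as arbitrary: P V)
  case Nil
  then show ?case using free_tree[of P V] by (auto simp: nowhere_Node)
next
  case (Cons a as)
  have P: "P 0 = {}" using Cons.prems(2)[of 0] by simp
  have "bounded_marks (\<lambda>d. P (Suc d) \<union> delay (length as) (marks (I a)) d)"
    using Cons.prems by (intro bounded_marks_Un bounded_marks_Suc bounded_marks_delay) auto
  from free_tree[OF this, of "{0, 2}"]
  obtain ts where ts: "pending child label (Node {0, 2} ts) (\<lambda>d. P (Suc d))"
    "pending child label (Node {0, 2} ts) (delay (length as) (marks (I a)))"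
    "everywhere 2 (Node {0, 2} ts)" "nowhere 3 (Node {0, 2} ts)"
    by (auto simp: pending_Un)
  obtain us where us: "pending child label (Node {2} us) (\<lambda>d. P (Suc d))" "everywhere 2 (Node {2} us)"
    "sat (Node {2} us) (comb (leaf al I) as)"
    using Cons.IH[of "\<lambda>d. P (Suc d)" "{2}"] Cons.prems bounded_marks_Suc by force
  show ?case
    using ts us P Cons.prems Box_leaf_sat[where I = I, OF ts(2,3)]
    by (intro exI[of _ "[Node {0, 2} ts, Node {2} us]"]) (auto simp: pending_Node everywhere_Node card_insert_if)
qed

section \<open>Completeness: building a model around a play\<close>

text \<open>The root label is universally quantified because the root may have to realise any mark.\<close>

definition realisable :: "(nat \<Rightarrow> nat set) \<Rightarrow> fm \<Rightarrow> bool" where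
  "realisable P \<phi> \<longleftrightarrow> (\<forall>V. {2, 3} \<subseteq> V \<longrightarrow>
     (\<exists>ts. pending child label (Node V ts) P \<and> everywhere 2 (Node V ts) \<and> sat (Node V ts) \<phi>))"

lemma realisable_Top: "bounded_marks P \<Longrightarrow> realisable P (Pos 2)"
proof -
  assume P: "bounded_marks P"
  have "\<exists>ts. pending child label (Node V ts) P \<and> everywhere 2 (Node V ts)" if "2 \<in> V" for V
  proof -
    obtain ts where "pending child label (Node (V - {3}) ts) P" "everywhere 2 (Node (V - {3}) ts)"
      using free_tree[OF P, of "V - {3}"] \<open>2 \<in> V\<close> by auto
    then show ?thesis using \<open>2 \<in> V\<close> by (auto simp: pending_Node everywhere_Node)
  qed
  then show ?thesis by (simp add: realisable_def)
qed

lemma realisable_leaf: "realisable P \<phi> \<Longrightarrow> realisable P (And (Pos 3) \<phi>)"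
  by (auto simp: realisable_def)

lemma realisable_Dia:
  assumes "P 0 = {}" "realisable (\<lambda>d. P (Suc d)) \<phi>"
  shows "realisable P (Dia \<phi>)"
  unfolding realisable_def
proof (intro allI impI)
  fix V :: "nat set" assume V: "{2, 3} \<subseteq> V"
  obtain ts where "pending child label (Node {2, 3} ts) (\<lambda>d. P (Suc d))" "everywhere 2 (Node {2, 3} ts)"
    "sat (Node {2, 3} ts) \<phi>"
    using assms(2) unfolding realisable_def by blast
  then show "\<exists>ts. pending child label (Node V ts) P \<and> everywhere 2 (Node V ts) \<and> sat (Node V ts) (Dia \<phi>)"
    using V assms(1) by (intro exI[of _ "[Node {2, 3} ts]"]) (simp add: pending_Node everywhere_Node)
qed

lemma realisable_Dias:
  assumes "\<And>d. d < n \<Longrightarrow> P d = {}" "realisable (\<lambda>d. P (d + n)) \<phi>"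
  shows "realisable P ((Dia ^^ n) \<phi>)"
  using assms
proof (induction n arbitrary: P)
  case (Suc n)
  have "realisable (\<lambda>d. P (Suc d)) ((Dia ^^ n) \<phi>)"
    using Suc.prems by (intro Suc.IH) auto
  then show ?case using Suc.prems(1)[of 0] by (simp add: realisable_Dia)
qed simp

text \<open>Give the world one successor for each mark that is due, at most two, and let every one
  of them realise \<open>\<phi>\<close>. This is where the freedom of the root label is
  used.\<close>

lemma realisable_check:
  assumes "P 0 \<subseteq> {..<3}" "\<not> {..<3} \<subseteq> P 0" "realisable (\<lambda>d. P (Suc d)) \<phi>"
  shows "realisable P (check \<phi>)"
  unfolding realisable_def
proof (intro allI impI)
  fix V :: "nat set" assume V: "{2, 3} \<subseteq> V"
  have "\<exists>ts. pending child label (Node ({2, 3} \<union> mark_label i) ts) (\<lambda>d. P (Suc d)) \<and>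
      everywhere 2 (Node ({2, 3} \<union> mark_label i) ts) \<and> sat (Node ({2, 3} \<union> mark_label i) ts) \<phi>" for i
    using assms(3) unfolding realisable_def by (auto simp: mark_label_def)
  then obtain u where u: "pending child label (Node ({2, 3} \<union> mark_label i) (u i)) (\<lambda>d. P (Suc d))"
    "everywhere 2 (Node ({2, 3} \<union> mark_label i) (u i))" "sat (Node ({2, 3} \<union> mark_label i) (u i)) \<phi>" for i
    by metis
  \<comment> \<open>If no mark is due, the diamond still needs a successor; mark 0 is then an
    arbitrary label for it.\<close>
  define ps where "ps = (if P 0 = {} then [0] else filter (\<lambda>i. i \<in> P 0) [0..<3])"
  let ?t = "\<lambda>i. Node ({2, 3} \<union> mark_label i) (u i)"
  have ne: "set ps \<noteq> {}" using assms(1) unfolding ps_def by (auto simp: subset_eq filter_empty_conv)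
  have sub: "P 0 \<subseteq> set ps" using assms(1) unfolding ps_def by auto
  have "card (set ps) \<le> 2"
  proof (cases "P 0 = {}")
    case False
    have "set ps \<subset> {..<3}" using assms(1,2) False unfolding ps_def by auto
    then have "card (set ps) < card {..<3::nat}" by (intro psubset_card_mono) auto
    then show ?thesis by simp
  qed (simp add: ps_def)
  then have "card (?t ` set ps) \<le> 2"
    using card_image_le[of "set ps" ?t] by simp
  moreover have "\<exists>i \<in> set ps. sat (?t i) \<phi>"
    using ne u(3) by (metis equals0I)
  ultimately have "sat (Node V (map ?t ps)) (check \<phi>)"
    by (simp only: check_def holds.simps children set_map child_iff) auto
  moreover have "pending child label (Node V (map ?t ps)) P"
    unfolding pending_Node
  proof (intro conjI ballI)
    fix i assume "i \<in> P 0"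
    then show "\<exists>t \<in> set (map ?t ps). sat t (mark i)"
      using sub mark_label[of "{2, 3}" i "u i"] by (intro bexI[of _ "?t i"]) auto
  qed (use u in auto)
  moreover have "everywhere 2 (Node V (map ?t ps))"
    using V u by (auto simp: everywhere_Node)
  ultimately show "\<exists>ts. pending child label (Node V ts) P \<and> everywhere 2 (Node V ts) \<and> sat (Node V ts) (check \<phi>)"
    by blast
qed

lemma realisable_checks:
  assumes "\<And>k. P k \<subseteq> {..<3}" "\<And>k. k < n \<Longrightarrow> \<not> {..<3} \<subseteq> P k" "realisable (\<lambda>d. P (d + n)) \<phi>"
  shows "realisable P ((check ^^ n) \<phi>)"
  using assms
proof (induction n arbitrary: P)
  case (Suc n)
  have "realisable (\<lambda>d. P (Suc d)) ((check ^^ n) \<phi>)"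
    using Suc.prems by (intro Suc.IH) auto
  then show ?case using Suc.prems(2)[of 0] Suc.prems(1) by (simp add: realisable_check)
qed simp

text \<open>The play goes through the branch of \<open>a\<close>. Symbols passed over before
  \<open>a\<close> get branches without variable 3, and what follows \<open>a\<close> in the comb is
  modelled by \<open>off_comb\<close>.\<close>

lemma realisable_comb:
  assumes "bounded_marks P" "\<And>d. d < length as \<Longrightarrow> P d = {}"
    "\<And>a. a \<in> set as \<Longrightarrow> bounded_marks (marks (I a))" "a \<in> set as" "al a"
    "realisable (\<lambda>d. P (d + length as) \<union> marks (I a) d) \<phi>"
  shows "realisable P (And (comb (leaf al I) as) ((Dia ^^ length as) (And (Pos 3) \<phi>)))"
  using assms
proof (induction as arbitrary: P)
  case (Cons b as)
  let ?\<psi> = "(Dia ^^ length as) (And (Pos 3) \<phi>)"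
  have P: "P 0 = {}" using Cons.prems(2)[of 0] by simp
  have bP: "bounded_marks (\<lambda>d. P (Suc d) \<union> delay (length as) (marks (I b)) d)"
    using Cons.prems by (intro bounded_marks_Un bounded_marks_Suc bounded_marks_delay) auto
  show ?case
    unfolding realisable_def
  proof (intro allI impI)
    fix V :: "nat set" assume V: "{2, 3} \<subseteq> V"
    have "\<exists>t u. pending child label t (\<lambda>d. P (Suc d)) \<and> everywhere 2 t \<and> sat t (Pos 0) \<and>
       sat t ((Box ^^ length as) (leaf al I b)) \<and>
       pending child label u (\<lambda>d. P (Suc d)) \<and> everywhere 2 u \<and> sat u (Neg 0) \<and>
       sat u (comb (leaf al I) as) \<and> (sat t ?\<psi> \<or> sat u ?\<psi>)"
    proof (cases "b = a")
      case True
      have "realisable (\<lambda>d. P (Suc d) \<union> delay (length as) (marks (I a)) d) ?\<psi>"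
      proof (rule realisable_Dias)
        show "P (Suc d) \<union> delay (length as) (marks (I a)) d = {}" if "d < length as" for d
          using that Cons.prems(2)[of "Suc d"] by (simp add: delay_def)
        have "delay (length as) (marks (I a)) (d + length as) = marks (I a) d" for d
          by (simp add: delay_def)
        then show "realisable (\<lambda>d. P (Suc (d + length as)) \<union>
            delay (length as) (marks (I a)) (d + length as)) (And (Pos 3) \<phi>)"
          using Cons.prems(6) by (intro realisable_leaf) simp
      qed
      then obtain ts where ts: "pending child label (Node {0, 2, 3} ts) (\<lambda>d. P (Suc d))"
        "pending child label (Node {0, 2, 3} ts) (delay (length as) (marks (I a)))"
        "everywhere 2 (Node {0, 2, 3} ts)" "sat (Node {0, 2, 3} ts) ?\<psi>"
        unfolding realisable_def pending_Un by (metis insert_subset subset_insertI)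
      moreover obtain us where "pending child label (Node {2} us) (\<lambda>d. P (Suc d))" "everywhere 2 (Node {2} us)"
        "sat (Node {2} us) (comb (leaf al I) as)"
        using off_comb[of "\<lambda>d. P (Suc d)" as "{2}" I al] Cons.prems bounded_marks_Suc by force
      ultimately show ?thesis
        using Box_leaf_sat[where I = I, OF ts(2,3)] True Cons.prems(5)
        by (intro exI[of _ "Node {0, 2, 3} ts"] exI[of _ "Node {2} us"]) simp
    next
      case False
      obtain ts where ts: "pending child label (Node {0, 2} ts) (\<lambda>d. P (Suc d))"
        "pending child label (Node {0, 2} ts) (delay (length as) (marks (I b)))"
        "everywhere 2 (Node {0, 2} ts)" "nowhere 3 (Node {0, 2} ts)"
        using free_tree[OF bP, of "{0, 2}"] by (auto simp: pending_Un)
      have "realisable (\<lambda>d. P (Suc d)) (And (comb (leaf al I) as) ?\<psi>)"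
        using Cons.prems False by (intro Cons.IH bounded_marks_Suc) auto
      then obtain us where "pending child label (Node {2, 3} us) (\<lambda>d. P (Suc d))"
        "everywhere 2 (Node {2, 3} us)" "sat (Node {2, 3} us) (And (comb (leaf al I) as) ?\<psi>)"
        unfolding realisable_def by blast
      with ts show ?thesis
        using Box_leaf_sat[where I = I, OF ts(2,3)]
        by (intro exI[of _ "Node {0, 2} ts"] exI[of _ "Node {2, 3} us"]) simp
    qed
    then obtain t u where tu: "pending child label t (\<lambda>d. P (Suc d))" "everywhere 2 t" "sat t (Pos 0)"
       "sat t ((Box ^^ length as) (leaf al I b))"
       "pending child label u (\<lambda>d. P (Suc d))" "everywhere 2 u" "sat u (Neg 0)"
       "sat u (comb (leaf al I) as)" "sat t ?\<psi> \<or> sat u ?\<psi>" by blast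
    then show "\<exists>ts. pending child label (Node V ts) P \<and> everywhere 2 (Node V ts) \<and>
        sat (Node V ts) (And (comb (leaf al I) (b # as)) ((Dia ^^ length (b # as)) (And (Pos 3) \<phi>)))"
      using V P by (intro exI[of _ "[t, u]"]) (auto simp: pending_Node everywhere_Node card_insert_if)
  qed
qed simp

section \<open>The game\<close>

datatype instr = Exists "nat \<Rightarrow> bool" | Forall

text \<open>A chunk consists of \<open>r\<close> levels in which a symbol or a bit is chosen, followed by \<open>c\<close> checks.
  The list \<open>I a\<close> (or \<open>J b\<close>) gives, for the chunk of the choice itself and for the chunks after it,
  the marks which that choice leaves pending at each check. Because all chunks have the same depth, these
  marks can be addressed by boxes alone.\<close>

definition stretch :: "nat \<Rightarrow> nat list list list \<Rightarrow> nat list list" where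
  "stretch r I = concat (map (\<lambda>c. c @ replicate r []) I)"

locale gadget =
  fixes r c :: nat and I :: "nat \<Rightarrow> nat list list list" and J :: "bool \<Rightarrow> nat list list list"
  assumes r: "0 < r"
    and I: "\<And>a S. S \<in> set (I a) \<Longrightarrow> length S = c \<and> \<Union> (set ` set S) \<subseteq> {..<3}"
    and J: "\<And>b S. S \<in> set (J b) \<Longrightarrow> length S = c \<and> \<Union> (set ` set S) \<subseteq> {..<3}"
begin

definition exists_chunk :: "(nat \<Rightarrow> bool) \<Rightarrow> fm \<Rightarrow> fm" where
  "exists_chunk al \<phi> = And (comb (leaf al (\<lambda>a. stretch r (I a))) [0..<r])
     ((Dia ^^ r) (And (Pos 3) ((check ^^ c) \<phi>)))"

text \<open>The two diamonds provide both values of the bit and the box continues the play after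
  each. The bit takes a single level; the further \<open>r - 1\<close> levels pad the chunk to the
  depth of an existential one.\<close>

definition forall_chunk :: "fm \<Rightarrow> fm" where
  "forall_chunk \<phi> =
     And (Dia (And (Pos 0) ((Box ^^ (r - 1)) (And (Pos 2) (info (stretch r (J True)))))))
    (And (Dia (And (Neg 0) ((Box ^^ (r - 1)) (And (Pos 2) (info (stretch r (J False)))))))
         (Box ((Dia ^^ (r - 1)) ((check ^^ c) \<phi>))))"

fun formula :: "instr list \<Rightarrow> fm" where
  "formula [] = Pos 2"
| "formula (Exists al # ps) = exists_chunk al (formula ps)"
| "formula (Forall # ps) = forall_chunk (formula ps)"

definition chunk_marks :: "nat list list list \<Rightarrow> nat \<Rightarrow> nat \<Rightarrow> nat set" where
  "chunk_marks K j k = (if j < length K \<and> k < c then set (K ! j ! k) else {})"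

definition consistent :: "(nat \<Rightarrow> nat set) \<Rightarrow> bool" where
  "consistent S \<longleftrightarrow> (\<forall>k<c. \<not> {..<3} \<subseteq> S k)"

text \<open>\<open>Q j k\<close> holds the marks due at check \<open>k\<close> of the chunk
  \<open>j\<close> places ahead. A choice adds its own marks before the checks of its chunk are
  judged, and then the schedule moves up by one chunk.\<close>

fun game :: "instr list \<Rightarrow> (nat \<Rightarrow> nat \<Rightarrow> nat set) \<Rightarrow> bool" where
  "game [] Q = True"
| "game (Exists al # ps) Q = (\<exists>a<r. al a \<and> consistent (\<lambda>k. Q 0 k \<union> chunk_marks (I a) 0 k) \<and>
     game ps (\<lambda>j k. Q (Suc j) k \<union> chunk_marks (I a) (Suc j) k))"
| "game (Forall # ps) Q = (\<forall>b. consistent (\<lambda>k. Q 0 k \<union> chunk_marks (J b) 0 k) \<and>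
     game ps (\<lambda>j k. Q (Suc j) k \<union> chunk_marks (J b) (Suc j) k))"

text \<open>Depths are counted from the first check of a chunk.\<close>

definition depth_marks :: "(nat \<Rightarrow> nat \<Rightarrow> nat set) \<Rightarrow> nat \<Rightarrow> nat set" where
  "depth_marks Q d = (if d mod (c + r) < c then Q (d div (c + r)) (d mod (c + r)) else {})"

lemma marks_stretch:
  assumes "\<And>S. S \<in> set K \<Longrightarrow> length S = c"
  shows "marks (stretch r K) = depth_marks (chunk_marks K)"
proof
  fix d
  show "marks (stretch r K) d = depth_marks (chunk_marks K) d"
    using assms
  proof (induction K arbitrary: d)
    case Nil
    then show ?case by (simp add: marks_def stretch_def depth_marks_def chunk_marks_def)
  next
    case (Cons S K)
    have S: "length S = c" using Cons.prems by simp
    have st: "stretch r (S # K) = S @ replicate r [] @ stretch r K" by (simp add: stretch_def)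
    show ?case
    proof (cases "d < c + r")
      case True
      then show ?thesis
        using S by (auto simp: marks_def st depth_marks_def chunk_marks_def nth_append)
    next
      case False
      then obtain e where e: "d = e + (c + r)" by (metis add.commute le_Suc_ex not_less)
      have "marks (stretch r (S # K)) d = marks (stretch r K) e"
        using S by (auto simp: marks_def st e nth_append)
      also have "\<dots> = depth_marks (chunk_marks K) e" using Cons by simp
      also have "\<dots> = depth_marks (chunk_marks (S # K)) d"
        using r by (simp add: depth_marks_def chunk_marks_def e)
      finally show ?thesis .
    qed
  qed
qed

lemma marks_I: "marks (stretch r (I a)) = depth_marks (chunk_marks (I a))"
  and marks_J: "marks (stretch r (J b)) = depth_marks (chunk_marks (J b))"
  using I J by (auto intro!: marks_stretch)

lemma depth_marks_Un: "depth_marks P d \<union> depth_marks Q d = depth_marks (\<lambda>j k. P j k \<union> Q j k) d"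
  by (simp add: depth_marks_def)

lemma depth_marks_check: "k < c \<Longrightarrow> depth_marks Q k = Q 0 k"
  by (simp add: depth_marks_def)

lemma bounded_depth_marks_Suc:
  assumes "bounded_marks (depth_marks Q)"
  shows "bounded_marks (depth_marks (\<lambda>j. Q (Suc j)))"
proof -
  have "depth_marks Q (d + (c + r)) = depth_marks (\<lambda>j. Q (Suc j)) d" for d
    using r by (simp only: depth_marks_def mod_add_self2) simp
  then show ?thesis using bounded_marks_shift[OF assms, of "c + r"] by simp
qed

text \<open>Behind the \<open>c\<close> checks only the schedule of the later chunks remains, and
  its first check is \<open>r\<close> choice levels away. This restores the invariant for the next
  chunk.\<close>

lemma depth_marks_shift: "(\<lambda>d. depth_marks Q (d + c)) = delay r (depth_marks (\<lambda>j. Q (Suc j)))"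
proof
  fix d
  show "depth_marks Q (d + c) = delay r (depth_marks (\<lambda>j. Q (Suc j))) d"
  proof (cases "d < r")
    case True
    then show ?thesis by (simp add: depth_marks_def delay_def)
  next
    case False
    then obtain e where "d = e + r" by (metis add.commute le_Suc_ex not_less)
    then have e: "d + c = e + (c + r)" "d = e + r" by simp_all
    show ?thesis unfolding depth_marks_def delay_def e(1) using r e(2) by simp
  qed
qed

text \<open>The delay by \<open>r\<close> reflects that a chunk begins with its choice levels. For
  an existential chunk the model reveals the chosen symbol through \<open>combD\<close>; for a
  universal one it contains both continuations. The checks then exclude inconsistent states.\<close>

lemma formula_game:
  assumes "holds R \<pi> w (formula ps)" "pending R \<pi> w (delay r (depth_marks Q))"
  shows "game ps Q"
  using assms
proof (induction ps Q arbitrary: w rule: game.induct)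
  case (2 al ps Q)
  obtain a v where av: "a < r" "al a" "holds R \<pi> v ((check ^^ c) (formula ps))"
    "pending R \<pi> v (depth_marks (\<lambda>j k. Q j k \<union> chunk_marks (I a) j k))"
    using combD[of R \<pi> w al "\<lambda>a. stretch r (I a)" "[0..<r]" "(check ^^ c) (formula ps)", OF _ _ "2.prems"(2)]
      "2.prems"(1)
    by (auto simp: exists_chunk_def delay_add marks_I depth_marks_Un)
  then show ?case
    using checksD[OF av(3,4)] "2.IH"
    by (auto simp: depth_marks_check depth_marks_shift consistent_def)
next
  case (3 ps Q)
  have "consistent (\<lambda>k. Q 0 k \<union> chunk_marks (J b) 0 k) \<and>
     game ps (\<lambda>j k. Q (Suc j) k \<union> chunk_marks (J b) (Suc j) k)" for b
  proof -
    obtain v where v: "(w, v) \<in> R" "holds R \<pi> v ((Dia ^^ (r - 1)) ((check ^^ c) (formula ps)))"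
      "holds R \<pi> v ((Box ^^ (r - 1)) (And (Pos 2) (info (stretch r (J b)))))"
      using "3.prems"(1) by (cases b) (auto simp: forall_chunk_def)
    have "pending R \<pi> v (delay (r - 1) (depth_marks Q))"
      using "3.prems"(2) v(1) r by (subst (asm) pending_unfold) (cases r; auto simp: delay_Suc)
    then have "pending R \<pi> v (\<lambda>d. delay (r - 1) (depth_marks Q) d \<union> delay (r - 1) (marks (stretch r (J b))) d)"
      using Box_info_pending[OF v(3)] by (simp add: pending_Un)
    from DiasD[OF v(2) this] obtain u where u: "holds R \<pi> u ((check ^^ c) (formula ps))"
      "pending R \<pi> u (depth_marks (\<lambda>j k. Q j k \<union> chunk_marks (J b) j k))"
      by (auto simp: delay_add marks_J depth_marks_Un)
    show ?thesis
      using checksD[OF u] "3.IH"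
      by (auto simp: depth_marks_check depth_marks_shift consistent_def)
  qed
  then show ?case by simp
qed simp

lemma bounded_chunk_marks:
  "bounded_marks (depth_marks (chunk_marks (I a)))" "bounded_marks (depth_marks (chunk_marks (J b)))"
proof -
  have "bounded_marks (marks (stretch r K))"
    if "\<And>S. S \<in> set K \<Longrightarrow> length S = c \<and> \<Union> (set ` set S) \<subseteq> {..<3}" for K
  proof (rule bounded_marks_marks, rule ballI)
    fix T assume "T \<in> set (stretch r K)"
    then consider S where "S \<in> set K" "T \<in> set S" | "T = []"
      by (auto simp: stretch_def split: if_splits)
    then show "set T \<subseteq> {..<3}" by cases (use that in blast, simp)
  qed
  from this[of "I a"] this[of "J b"] I J
  show "bounded_marks (depth_marks (chunk_marks (I a)))" "bounded_marks (depth_marks (chunk_marks (J b)))"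
    by (auto simp: marks_I marks_J)
qed

text \<open>The delayed schedule leaves the choice levels free of marks, as
  \<open>realisable_comb\<close> demands, and consistency leaves at most two marks at each
  check.\<close>

lemma game_formula:
  assumes "game ps Q" "bounded_marks (depth_marks Q)"
  shows "realisable (delay r (depth_marks Q)) (formula ps)"
  using assms
proof (induction ps Q rule: game.induct)
  case (1 Q)
  then show ?case by (simp add: realisable_Top bounded_marks_delay)
next
  case (2 al ps Q)
  then obtain a where a: "a < r" "al a" "consistent (\<lambda>k. Q 0 k \<union> chunk_marks (I a) 0 k)"
    "game ps (\<lambda>j k. Q (Suc j) k \<union> chunk_marks (I a) (Suc j) k)" by auto
  let ?Q = "\<lambda>j k. Q j k \<union> chunk_marks (I a) j k"
  have Q: "bounded_marks (depth_marks ?Q)"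
    using bounded_marks_Un[OF "2.prems"(2) bounded_chunk_marks(1)[of a]] by (simp add: depth_marks_Un)
  have "bounded_marks (depth_marks (\<lambda>j. ?Q (Suc j)))"
    using bounded_depth_marks_Suc[OF Q] by simp
  then have IH: "realisable (\<lambda>d. depth_marks ?Q (d + c)) (formula ps)"
    unfolding depth_marks_shift by (rule "2.IH"[OF a(4)])
  have "realisable (depth_marks ?Q) ((check ^^ c) (formula ps))"
    using Q a(3) IH
    by (intro realisable_checks) (auto simp: bounded_marks_def depth_marks_check consistent_def)
  then show ?case
    unfolding formula.simps exists_chunk_def
    using a realisable_comb[of "delay r (depth_marks Q)" "[0..<r]" "\<lambda>a. stretch r (I a)" a al
       "(check ^^ c) (formula ps)"] bounded_chunk_marks "2.prems"(2)
    by (simp add: marks_I bounded_marks_delay delay_add depth_marks_Un delay_less)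
next
  case (3 ps Q)
  let ?\<psi> = "(Dia ^^ (r - 1)) ((check ^^ c) (formula ps))"
  have *: "realisable (\<lambda>d. delay (r - 1) (depth_marks Q) d \<union> delay (r - 1) (marks (stretch r (J b))) d) ?\<psi>" for b
  proof -
    let ?Q = "\<lambda>j k. Q j k \<union> chunk_marks (J b) j k"
    have b: "consistent (\<lambda>k. Q 0 k \<union> chunk_marks (J b) 0 k)"
      "game ps (\<lambda>j k. Q (Suc j) k \<union> chunk_marks (J b) (Suc j) k)" using "3.prems" by auto
    have Q: "bounded_marks (depth_marks ?Q)"
      using bounded_marks_Un[OF "3.prems"(2) bounded_chunk_marks(2)[of b]] by (simp add: depth_marks_Un)
    have "bounded_marks (depth_marks (\<lambda>j. ?Q (Suc j)))"
      using bounded_depth_marks_Suc[OF Q] by simp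
    then have IH: "realisable (\<lambda>d. depth_marks ?Q (d + c)) (formula ps)"
      unfolding depth_marks_shift by (rule "3.IH"[OF b(2)])
    have "realisable (depth_marks ?Q) ((check ^^ c) (formula ps))"
      using Q b(1) IH
      by (intro realisable_checks) (auto simp: bounded_marks_def depth_marks_check consistent_def)
    then show ?thesis
      by (intro realisable_Dias) (simp_all add: delay_add delay_less marks_J depth_marks_Un)
  qed
  show ?case
    unfolding realisable_def
  proof (intro allI impI)
    fix V :: "nat set" assume V: "{2, 3} \<subseteq> V"
    obtain ts where ts: "pending child label (Node {0, 2, 3} ts) (delay (r - 1) (depth_marks Q))"
      "pending child label (Node {0, 2, 3} ts) (delay (r - 1) (marks (stretch r (J True))))"
      "everywhere 2 (Node {0, 2, 3} ts)" "sat (Node {0, 2, 3} ts) ?\<psi>"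
      using *[of True] unfolding realisable_def pending_Un by (metis insert_subset subset_insertI)
    obtain us where us: "pending child label (Node {2, 3} us) (delay (r - 1) (depth_marks Q))"
      "pending child label (Node {2, 3} us) (delay (r - 1) (marks (stretch r (J False))))"
      "everywhere 2 (Node {2, 3} us)" "sat (Node {2, 3} us) ?\<psi>"
      using *[of False] unfolding realisable_def pending_Un by blast
    \<comment> \<open>What a bit leaves behind has the form of an always allowed leaf, so the
      statement about leaves applies with a dummy symbol.\<close>
    have l: "leaf (\<lambda>_. True) (\<lambda>_. stretch r (J b)) 0 = And (Pos 2) (info (stretch r (J b)))" for b
      by (simp add: leaf_def)
    have "sat (Node {0, 2, 3} ts) ((Box ^^ (r - 1)) (And (Pos 2) (info (stretch r (J True)))))"
      "sat (Node {2, 3} us) ((Box ^^ (r - 1)) (And (Pos 2) (info (stretch r (J False)))))"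
      using Box_leaf_sat[of _ "r - 1" "\<lambda>_. stretch r (J True)" 0 "\<lambda>_. True", OF ts(2,3)]
        Box_leaf_sat[of _ "r - 1" "\<lambda>_. stretch r (J False)" 0 "\<lambda>_. True", OF us(2,3)]
      unfolding l by auto
    moreover have "delay r (depth_marks Q) 0 = {}" "(\<lambda>d. delay r (depth_marks Q) (Suc d)) = delay (r - 1) (depth_marks Q)"
      using r by (cases r; simp add: delay_Suc)+
    ultimately show "\<exists>ts. pending child label (Node V ts) (delay r (depth_marks Q)) \<and> everywhere 2 (Node V ts) \<and>
        sat (Node V ts) (formula (Forall # ps))"
      using V ts us
      by (intro exI[of _ "[Node {0, 2, 3} ts, Node {2, 3} us]"])
        (auto simp: pending_Node everywhere_Node forall_chunk_def)
  qed
qed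

theorem satisfiable_formula:
  assumes "infinite (UNIV :: 'w set)"
  shows "satisfiable TYPE('w) (formula ps) \<longleftrightarrow> game ps (\<lambda>_ _. {})"
proof
  assume "satisfiable TYPE('w) (formula ps)"
  then obtain R :: "('w \<times> 'w) set" and \<pi> w where "holds R \<pi> w (formula ps)"
    by (auto simp: satisfiable_def)
  then show "game ps (\<lambda>_ _. {})"
    by (rule formula_game) (simp add: pending_def delay_def depth_marks_def)
next
  assume "game ps (\<lambda>_ _. {})"
  then have "realisable (delay r (depth_marks (\<lambda>_ _. {}))) (formula ps)"
    by (rule game_formula) (simp add: bounded_marks_def depth_marks_def)
  then obtain ts where "sat (Node {2, 3} ts) (formula ps)"
    unfolding realisable_def by blast
  then have "satisfiable TYPE(tree) (formula ps)"
    unfolding satisfiable_def kripke_model_def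
    by (intro exI[of _ UNIV] exI[of _ child] exI[of _ label]) auto
  then show "satisfiable TYPE('w) (formula ps)"
    using assms satisfiable_transfer by blast
qed

end

section \<open>Tilings\<close>

text \<open>A block of \<open>Suc w\<close> cells is chosen after each bit. An entry \<open>(0, x, y)\<close> of \<open>cs\<close> forbids \<open>x\<close> to the left
  of \<open>y\<close>, an entry \<open>(1, x, y)\<close> (or \<open>(2, x, y)\<close>) forbids \<open>y\<close> in the place that had \<open>x\<close> in the
  previous block if the bit between them was true (or false). The check for an entry fails when mark 0
  is left by \<open>y\<close>, mark 1 by \<open>x\<close>, and mark 2 by the bit (or by \<open>y\<close>, if no bit is involved).\<close>

locale tiling =
  fixes r w :: nat and cs :: "(nat \<times> nat \<times> nat) list"
  assumes r: "0 < r"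
begin

definition none :: "nat list list" where
  "none = map (\<lambda>_. []) cs"

definition right_marks :: "nat \<Rightarrow> nat list list" where
  "right_marks a = map (\<lambda>(k, x, y). if y = a then (if k = 0 then [0, 2] else [0]) else []) cs"

definition left_marks :: "nat \<Rightarrow> nat list list" where
  "left_marks a = map (\<lambda>(k, x, y). if k = 0 \<and> x = a then [1] else []) cs"

definition upper_marks :: "nat \<Rightarrow> nat list list" where
  "upper_marks a = map (\<lambda>(k, x, y). if k \<noteq> 0 \<and> x = a then [1] else []) cs"

definition bit_kind :: "bool \<Rightarrow> nat" where
  "bit_kind b = (if b then 1 else 2)"

definition bit_marks :: "bool \<Rightarrow> nat list list" where
  "bit_marks b = map (\<lambda>(k, x, y). if k = bit_kind b then [2] else []) cs"

text \<open>A block of \<open>Suc w\<close> cells is followed by one bit, so the same place in the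
  next block lies \<open>w + 2\<close> chunks ahead. The left marks go to the next chunk, which for
  the last cell of a block is the chunk of the bit.\<close>

definition cell_info :: "nat \<Rightarrow> nat list list list" where
  "cell_info a = right_marks a # left_marks a # replicate w none @ [upper_marks a]"

definition bit_info :: "bool \<Rightarrow> nat list list list" where
  "bit_info b = none # replicate (Suc w) (bit_marks b)"

sublocale gadget r "length cs" cell_info bit_info
proof
  have "\<Union> (set ` set none) \<subseteq> {..<3}" "\<Union> (set ` set (right_marks a)) \<subseteq> {..<3}"
    "\<Union> (set ` set (left_marks a)) \<subseteq> {..<3}" "\<Union> (set ` set (upper_marks a)) \<subseteq> {..<3}"
    "\<Union> (set ` set (bit_marks b)) \<subseteq> {..<3}" for a b
    unfolding none_def right_marks_def left_marks_def upper_marks_def bit_marks_def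
    by (auto split: if_splits prod.splits)
  note sub = this
  have len: "length none = length cs" "length (right_marks a) = length cs"
    "length (left_marks a) = length cs" "length (upper_marks a) = length cs"
    "length (bit_marks b) = length cs" for a b
    unfolding none_def right_marks_def left_marks_def upper_marks_def bit_marks_def by auto
  show "length S = length cs \<and> \<Union> (set ` set S) \<subseteq> {..<3}" if "S \<in> set (cell_info a)" for a S
  proof -
    have "S \<in> {right_marks a, left_marks a, none, upper_marks a}"
      using that by (auto simp: cell_info_def)
    then show ?thesis using sub len by fastforce
  qed
  show "length S = length cs \<and> \<Union> (set ` set S) \<subseteq> {..<3}" if "S \<in> set (bit_info b)" for b S
  proof -
    have "S \<in> {none, bit_marks b}"
      using that by (auto simp: bit_info_def split: if_splits)
    then show ?thesis using sub len by fastforce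
  qed
qed (rule r)

definition marks_at :: "nat list list \<Rightarrow> nat \<Rightarrow> nat set" where
  "marks_at S k = (if k < length cs then set (S ! k) else {})"

lemma cell_marks: "chunk_marks (cell_info a) j k =
  (if j = 0 then marks_at (right_marks a) k else if j = 1 then marks_at (left_marks a) k
   else if j = w + 2 then marks_at (upper_marks a) k else {})"
  unfolding chunk_marks_def cell_info_def marks_at_def none_def
  by (auto simp: nth_append nth_Cons split: nat.splits)

lemma bit_marks: "chunk_marks (bit_info b) j k =
  (if 0 < j \<and> j \<le> Suc w then marks_at (bit_marks b) k else {})"
  unfolding chunk_marks_def bit_info_def marks_at_def none_def
  by (auto simp: nth_append nth_Cons split: nat.splits)

text \<open>The schedule when the cells \<open>T\<close> of the current block have been chosen and
  \<open>prev\<close> gives the previous block and the bit after it. The cell \<open>T ! i\<close>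
  was chosen \<open>length T - i\<close> chunks ago, so its upper marks are due
  \<open>w + 2 - (length T - i)\<close> chunks ahead; solving for \<open>i\<close> gives the index
  in the last line, and \<open>j < w + 2\<close> keeps it within \<open>T\<close>.\<close>

definition state :: "(nat list \<times> bool) option \<Rightarrow> nat list \<Rightarrow> nat \<Rightarrow> nat \<Rightarrow> nat set" where
  "state prev T j k =
     (if j = 0 \<and> T \<noteq> [] then marks_at (left_marks (last T)) k else {}) \<union>
     (case prev of None \<Rightarrow> {} | Some (U, b) \<Rightarrow>
        if j + length T \<le> w then marks_at (upper_marks (U ! (j + length T))) k \<union> marks_at (bit_marks b) k else {}) \<union>
     (if w + 2 \<le> j + length T \<and> j < w + 2 then marks_at (upper_marks (T ! (j + length T - (w + 2)))) k else {})"

definition fits :: "(nat list \<times> bool) option \<Rightarrow> nat list \<Rightarrow> nat \<Rightarrow> bool" where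
  "fits prev T a \<longleftrightarrow> (T \<noteq> [] \<longrightarrow> (0, last T, a) \<notin> set cs) \<and>
     (\<forall>U b. prev = Some (U, b) \<longrightarrow> (bit_kind b, U ! length T, a) \<notin> set cs)"

lemma state_step:
  "(\<lambda>j k. state prev T (Suc j) k \<union> chunk_marks (cell_info a) (Suc j) k) = state prev (T @ [a])"
proof (intro ext)
  fix j k
  have "j + length (T @ [a]) = Suc j + length T" by simp
  moreover have "(if w + 2 \<le> Suc j + length T \<and> j < w + 2
        then marks_at (upper_marks ((T @ [a]) ! (Suc j + length T - (w + 2)))) k else {}) =
     (if w + 2 \<le> Suc j + length T \<and> Suc j < w + 2
        then marks_at (upper_marks (T ! (Suc j + length T - (w + 2)))) k else {}) \<union>
     (if Suc j = w + 2 then marks_at (upper_marks a) k else {})"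
    by (auto simp: nth_append)
  ultimately show "state prev T (Suc j) k \<union> chunk_marks (cell_info a) (Suc j) k = state prev (T @ [a]) j k"
    unfolding state_def cell_marks by (auto split: option.splits)
qed

text \<open>Check \<open>k\<close> belongs to entry \<open>k\<close> of \<open>cs\<close>. There
  mark 0 comes only from the new symbol, mark 1 only from the left neighbour or the previous block,
  according to the kind of the entry, and mark 2 from the new symbol or the bit. So all three meet
  exactly for a forbidden combination.\<close>

lemma consistent_state:
  assumes "length T \<le> w"
  shows "consistent (\<lambda>k. state prev T 0 k \<union> chunk_marks (cell_info a) 0 k) \<longleftrightarrow> fits prev T a"
proof -
  have three: "{..<3::nat} = {0, 1, 2}" by auto
  have "{..<3} \<subseteq> state prev T 0 k \<union> chunk_marks (cell_info a) 0 k \<longleftrightarrow>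
      (T \<noteq> [] \<and> cs ! k = (0, last T, a)) \<or>
      (\<exists>U b. prev = Some (U, b) \<and> cs ! k = (bit_kind b, U ! length T, a))" if k: "k < length cs" for k
  proof -
    obtain i x y where e: "cs ! k = (i, x, y)" by (cases "cs ! k")
    have m: "marks_at (right_marks t) k = (if y = t then (if i = 0 then {0, 2} else {0}) else {})"
      "marks_at (left_marks t) k = (if i = 0 \<and> x = t then {1} else {})"
      "marks_at (upper_marks t) k = (if i \<noteq> 0 \<and> x = t then {1} else {})"
      "marks_at (bit_marks b) k = (if i = bit_kind b then {2} else {})" for t b
      using k by (simp_all add: marks_at_def right_marks_def left_marks_def upper_marks_def bit_marks_def e)
    have "state prev T 0 k \<union> chunk_marks (cell_info a) 0 k =
       (if T \<noteq> [] \<and> i = 0 \<and> x = last T then {1} else {}) \<union>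
       (case prev of None \<Rightarrow> {} | Some (U, b) \<Rightarrow>
          (if i \<noteq> 0 \<and> x = U ! length T then {1} else {}) \<union> (if i = bit_kind b then {2} else {})) \<union>
       (if y = a then if i = 0 then {0, 2} else {0} else {})"
      using assms unfolding state_def cell_marks m by (simp split: option.split)
    moreover have "bit_kind b \<noteq> 0" for b by (simp add: bit_kind_def)
    ultimately show ?thesis
      unfolding three e by (cases prev; cases "i = 0"; cases "y = a") (auto split: if_splits)
  qed
  then show ?thesis
    unfolding consistent_def fits_def by (auto simp: in_set_conv_nth)
qed

lemma game_cells:
  assumes "length T + length als = Suc w"
  shows "game (map Exists als @ rest) (state prev T) \<longleftrightarrow>
    (\<exists>U. length U = length als \<and>
      (\<forall>i<length als. U ! i < r \<and> (als ! i) (U ! i) \<and> fits prev (T @ take i U) (U ! i)) \<and>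
      game rest (state prev (T @ U)))"
  using assms
proof (induction als arbitrary: T)
  case Nil
  then show ?case by simp
next
  case (Cons al als)
  have "game (map Exists (al # als) @ rest) (state prev T) \<longleftrightarrow>
     (\<exists>a<r. al a \<and> fits prev T a \<and> game (map Exists als @ rest) (state prev (T @ [a])))"
    using Cons.prems by (simp add: state_step consistent_state)
  also have "\<dots> \<longleftrightarrow> (\<exists>a U. a < r \<and> al a \<and> fits prev T a \<and> length U = length als \<and>
      (\<forall>i<length als. U ! i < r \<and> (als ! i) (U ! i) \<and> fits prev (T @ a # take i U) (U ! i)) \<and>
      game rest (state prev (T @ a # U)))"
    using Cons by auto
  also have "\<dots> \<longleftrightarrow> (\<exists>V. length V = length (al # als) \<and>
      (\<forall>i<length (al # als). V ! i < r \<and> ((al # als) ! i) (V ! i) \<and> fits prev (T @ take i V) (V ! i)) \<and>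
      game rest (state prev (T @ V)))" (is "?L \<longleftrightarrow> (\<exists>V. ?R V)")
  proof
    assume ?L
    then obtain a U where "a < r" "al a" "fits prev T a" "length U = length als"
      "\<forall>i<length als. U ! i < r \<and> (als ! i) (U ! i) \<and> fits prev (T @ a # take i U) (U ! i)"
      "game rest (state prev (T @ a # U))" by blast
    then have "?R (a # U)" by (auto simp: less_Suc_eq_0_disj)
    then show "\<exists>V. ?R V" by blast
  next
    assume "\<exists>V. ?R V"
    then obtain V where V: "?R V" by blast
    then obtain a U where e: "V = a # U" by (cases V) auto
    show ?L
    proof (intro exI conjI allI impI)
      show "a < r" "al a" "fits prev T a" "length U = length als" "game rest (state prev (T @ a # U))"
        using V by (auto simp: e)
      fix i assume "i < length als"
      with V show "U ! i < r" "(als ! i) (U ! i)" "fits prev (T @ a # take i U) (U ! i)"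
        by (auto simp: e dest: spec[of _ "Suc i"])
    qed
  qed
  finally show ?case .
qed

definition word :: "(nat \<Rightarrow> bool) list \<Rightarrow> (nat list \<times> bool) option \<Rightarrow> nat list \<Rightarrow> bool" where
  "word als prev U \<longleftrightarrow> length U = Suc w \<and>
     (\<forall>i\<le>w. U ! i < r \<and> (als ! i) (U ! i) \<and> (0 < i \<longrightarrow> (0, U ! (i - 1), U ! i) \<notin> set cs) \<and>
       (\<forall>V b. prev = Some (V, b) \<longrightarrow> (bit_kind b, V ! i, U ! i) \<notin> set cs))"

lemma game_block:
  assumes "length als = Suc w"
  shows "game (map Exists als @ rest) (state prev []) \<longleftrightarrow>
    (\<exists>U. word als prev U \<and> game rest (state prev U))"
proof -
  have "fits prev (take i U) (U ! i) \<longleftrightarrow> (0 < i \<longrightarrow> (0, U ! (i - 1), U ! i) \<notin> set cs) \<and>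
       (\<forall>V b. prev = Some (V, b) \<longrightarrow> (bit_kind b, V ! i, U ! i) \<notin> set cs)"
    if "length U = Suc w" "i \<le> w" for U i
  proof -
    have "last (take i U) = U ! (i - 1)" if "0 < i"
      using that \<open>i \<le> w\<close> \<open>length U = Suc w\<close> by (subst last_conv_nth) auto
    then show ?thesis using that by (auto simp: fits_def)
  qed
  then show ?thesis
    using assms unfolding word_def by (auto simp: game_cells less_Suc_eq_le)
qed

lemma state_Forall:
  assumes "length U = Suc w"
  shows "(\<lambda>j k. state prev U (Suc j) k \<union> chunk_marks (bit_info b) (Suc j) k) = state (Some (U, b)) []"
  using assms by (intro ext) (auto simp: state_def bit_marks split: option.splits)

text \<open>Mark 0 is left by a symbol in its own chunk only, so no check in the chunk of a bit can
  fail; the left marks of the last cell, which fall due here, are harmless.\<close>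

lemma game_Forall:
  assumes "length U = Suc w"
  shows "game (Forall # rest) (state prev U) \<longleftrightarrow> (\<forall>b. game rest (state (Some (U, b)) []))"
proof -
  have "0 \<notin> state prev U 0 k \<union> chunk_marks (bit_info b) 0 k" for k b
    using assms by (auto simp: state_def bit_marks marks_at_def left_marks_def split: option.splits prod.splits if_splits)
  then have "consistent (\<lambda>k. state prev U 0 k \<union> chunk_marks (bit_info b) 0 k)" for b
    unfolding consistent_def by force
  then show ?thesis by (simp add: state_Forall[OF assms])
qed

section \<open>Blocks alternating with bits\<close>

definition rounds :: "nat \<Rightarrow> (nat \<Rightarrow> bool) list \<Rightarrow> (nat \<Rightarrow> bool) \<Rightarrow> instr list" where
  "rounds m als fin = map Exists als @
     concat (replicate m (Forall # map Exists (replicate (Suc w) (\<lambda>_. True)))) @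
     Forall # map Exists (replicate (Suc w) fin)"

primrec wins :: "(nat \<Rightarrow> bool) \<Rightarrow> nat \<Rightarrow> nat list \<Rightarrow> bool" where
  "wins fin 0 U = (\<forall>b. \<exists>V. word (replicate (Suc w) fin) (Some (U, b)) V)"
| "wins fin (Suc m) U = (\<forall>b. \<exists>V. word (replicate (Suc w) (\<lambda>_. True)) (Some (U, b)) V \<and> wins fin m V)"

lemma game_wins:
  assumes "length U = Suc w"
  shows "game (concat (replicate m (Forall # map Exists (replicate (Suc w) (\<lambda>_. True)))) @
     Forall # map Exists (replicate (Suc w) fin)) (state prev U) \<longleftrightarrow> wins fin m U"
  using assms
proof (induction m arbitrary: U prev)
  case 0
  have "game (map Exists (replicate (Suc w) fin)) (state (Some (U, b)) []) \<longleftrightarrow>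
     (\<exists>V. word (replicate (Suc w) fin) (Some (U, b)) V)" for b
    using game_block[of "replicate (Suc w) fin" "[]"] by simp
  then show ?case
    by (simp only: replicate_0 concat.simps append_Nil wins.simps game_Forall[OF 0])
next
  case (Suc m)
  let ?rest = "concat (replicate m (Forall # map Exists (replicate (Suc w) (\<lambda>_. True)))) @
     Forall # map Exists (replicate (Suc w) fin)"
  have "game (map Exists (replicate (Suc w) (\<lambda>_. True)) @ ?rest) (state (Some (U, b)) []) \<longleftrightarrow>
     (\<exists>V. word (replicate (Suc w) (\<lambda>_. True)) (Some (U, b)) V \<and> wins fin m V)" for b
    using game_block[of "replicate (Suc w) (\<lambda>_. True)" ?rest] Suc.IH by (auto simp: word_def)
  then show ?case
    by (simp only: replicate_Suc concat.simps append_assoc append_Cons wins.simps game_Forall[OF Suc.prems])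
qed

lemma game_rounds:
  assumes "length als = Suc w"
  shows "game (rounds m als fin) (\<lambda>_ _. {}) \<longleftrightarrow> (\<exists>U. word als None U \<and> wins fin m U)"
proof -
  have "state None [] = (\<lambda>_ _. {})" by (intro ext) (auto simp: state_def)
  then show ?thesis
    using game_block[OF assms, of _ None] game_wins unfolding rounds_def
    by (metis (no_types, lifting) word_def)
qed

end

section \<open>Savitch's recursion\<close>

text \<open>Each symbol of the tiling is a triple \<open>(X, Z, Y)\<close>; a word of triples asserts that \<open>Z\<close> lies halfway between
  \<open>X\<close> and \<open>Y\<close>. The following bit selects the half that is to be divided next.\<close>

definition conflict :: "(nat \<Rightarrow> 'c \<times> 'c \<times> 'c) \<Rightarrow> ('c \<Rightarrow> 'c \<Rightarrow> bool) \<Rightarrow> nat \<times> nat \<times> nat \<Rightarrow> bool" where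
  "conflict dec h = (\<lambda>(k, a, b). case (dec a, dec b) of ((X, Z, Y), (X', Z', Y')) \<Rightarrow>
     if k = 0 then \<not> (h X X' \<and> h Z Z' \<and> h Y Y')
     else if k = 1 then \<not> (X' = X \<and> Y' = Z) else \<not> (X' = Z \<and> Y' = Y))"

definition conflicts :: "(nat \<Rightarrow> 'c \<times> 'c \<times> 'c) \<Rightarrow> ('c \<Rightarrow> 'c \<Rightarrow> bool) \<Rightarrow> nat \<Rightarrow> (nat \<times> nat \<times> nat) list" where
  "conflicts dec h r =
     filter (conflict dec h) (List.product [0..<3] (List.product [0..<r] [0..<r]))"

definition valid_word :: "nat \<Rightarrow> 'c set \<Rightarrow> ('c \<Rightarrow> 'c \<Rightarrow> bool) \<Rightarrow> 'c list \<Rightarrow> bool" where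
  "valid_word w S h X \<longleftrightarrow> length X = Suc w \<and> set X \<subseteq> S \<and> (\<forall>i<w. h (X ! i) (X ! Suc i))"

definition word_moves :: "nat \<Rightarrow> 'c set \<Rightarrow> ('c \<Rightarrow> 'c \<Rightarrow> bool) \<Rightarrow> ('c \<Rightarrow> 'c \<Rightarrow> bool) \<Rightarrow> ('c list \<times> 'c list) set" where
  "word_moves w S h v = {(X, Y). valid_word w S h X \<and> valid_word w S h Y \<and> (\<forall>i\<le>w. v (X ! i) (Y ! i))}"

locale savitch =
  fixes w r :: nat and dec :: "nat \<Rightarrow> 'c \<times> 'c \<times> 'c" and S :: "'c set" and h v :: "'c \<Rightarrow> 'c \<Rightarrow> bool"
  assumes dec: "bij_betw dec {..<r} (S \<times> S \<times> S)" and r: "0 < r"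
begin

sublocale tiling r w "conflicts dec h r"
  by standard (rule r)

definition start :: "nat list \<Rightarrow> 'c list" where
  "start U = map (\<lambda>a. fst (dec a)) U"

definition middle :: "nat list \<Rightarrow> 'c list" where
  "middle U = map (\<lambda>a. fst (snd (dec a))) U"

definition goal :: "nat list \<Rightarrow> 'c list" where
  "goal U = map (\<lambda>a. snd (snd (dec a))) U"

abbreviation valid :: "'c list \<Rightarrow> bool" where
  "valid \<equiv> valid_word w S h"

definition proper :: "nat list \<Rightarrow> bool" where
  "proper U \<longleftrightarrow> length U = Suc w \<and> set U \<subseteq> {..<r} \<and> valid (start U) \<and> valid (middle U) \<and> valid (goal U)"

lemma conflict_iff: "conflict dec h (k, a, b) \<longleftrightarrow>
    (if k = 0 then \<not> (h (fst (dec a)) (fst (dec b)) \<and> h (fst (snd (dec a))) (fst (snd (dec b))) \<and>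
         h (snd (snd (dec a))) (snd (snd (dec b))))
     else if k = 1 then \<not> (fst (dec b) = fst (dec a) \<and> snd (snd (dec b)) = fst (snd (dec a)))
     else \<not> (fst (dec b) = fst (snd (dec a)) \<and> snd (snd (dec b)) = snd (snd (dec a))))"
  by (simp add: conflict_def case_prod_beta)

lemma conflict_set: "a < r \<Longrightarrow> b < r \<Longrightarrow> k < 3 \<Longrightarrow>
    (k, a, b) \<in> set (conflicts dec h r) \<longleftrightarrow> conflict dec h (k, a, b)"
  by (auto simp: conflicts_def)

lemma valid_nth: "length X = Suc w \<Longrightarrow>
    valid X \<longleftrightarrow> (\<forall>i\<le>w. X ! i \<in> S) \<and> (\<forall>i\<le>w. 0 < i \<longrightarrow> h (X ! (i - 1)) (X ! i))"
proof -
  assume "length X = Suc w"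
  moreover have "(\<forall>i<w. h (X ! i) (X ! Suc i)) \<longleftrightarrow> (\<forall>i\<le>w. 0 < i \<longrightarrow> h (X ! (i - 1)) (X ! i))"
    by (metis Suc_leI Suc_pred diff_Suc_1 less_eq_Suc_le zero_less_Suc)
  ultimately show ?thesis
    by (auto simp: valid_word_def subset_iff all_set_conv_all_nth less_Suc_eq_le simp flip: Ball_def)
qed

lemma proper_nth: "proper U \<longleftrightarrow> length U = Suc w \<and>
    (\<forall>i\<le>w. U ! i < r \<and> (0 < i \<longrightarrow> (0, U ! (i - 1), U ! i) \<notin> set (conflicts dec h r)))"
proof (cases "length U = Suc w \<and> (\<forall>i\<le>w. U ! i < r)")
  case True
  have "dec (U ! i) \<in> S \<times> S \<times> S" if "i \<le> w" for i
    using bij_betwE[OF dec] True that by blast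
  then have S: "fst (dec (U ! i)) \<in> S" "fst (snd (dec (U ! i))) \<in> S" "snd (snd (dec (U ! i))) \<in> S"
    if "i \<le> w" for i using that by (auto simp: mem_Times_iff)
  have "set U \<subseteq> {..<r}"
    using True by (auto simp: in_set_conv_nth less_Suc_eq_le)
  then have "proper U \<longleftrightarrow> (\<forall>i\<le>w. 0 < i \<longrightarrow>
      h (start U ! (i - 1)) (start U ! i) \<and> h (middle U ! (i - 1)) (middle U ! i) \<and>
      h (goal U ! (i - 1)) (goal U ! i))"
    using True S unfolding proper_def
    by (subst valid_nth, simp add: start_def, subst valid_nth, simp add: middle_def,
        subst valid_nth, simp add: goal_def)
      (auto simp: start_def middle_def goal_def less_Suc_eq_le)
  also have "\<dots> \<longleftrightarrow> (\<forall>i\<le>w. 0 < i \<longrightarrow> (0, U ! (i - 1), U ! i) \<notin> set (conflicts dec h r))"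
    using True by (auto simp: conflict_set conflict_iff start_def middle_def goal_def less_Suc_eq_le)
  finally show ?thesis using True by auto
next
  case False
  then show ?thesis
    by (auto simp: proper_def subset_iff all_set_conv_all_nth less_Suc_eq_le simp flip: Ball_def)
qed

lemma word_None: "word als None U \<longleftrightarrow> proper U \<and> (\<forall>i\<le>w. (als ! i) (U ! i))"
  by (auto simp: word_def proper_nth)

lemma word_Some:
  assumes "proper T"
  shows "word als (Some (T, b)) U \<longleftrightarrow> proper U \<and> (\<forall>i\<le>w. (als ! i) (U ! i)) \<and>
    (if b then start U = start T \<and> goal U = middle T else start U = middle T \<and> goal U = goal T)"
proof -
  have *: "word als (Some (T, b)) U \<longleftrightarrow> proper U \<and> (\<forall>i\<le>w. (als ! i) (U ! i)) \<and>
      (\<forall>i\<le>w. (bit_kind b, T ! i, U ! i) \<notin> set (conflicts dec h r))"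
    by (auto simp: word_def proper_nth)
  have "(\<forall>i\<le>w. (bit_kind b, T ! i, U ! i) \<notin> set (conflicts dec h r)) \<longleftrightarrow>
    (if b then start U = start T \<and> goal U = middle T else start U = middle T \<and> goal U = goal T)"
    if "proper U"
  proof -
    have len: "length T = Suc w" "length U = Suc w" and "\<And>i. i \<le> w \<Longrightarrow> T ! i < r \<and> U ! i < r"
      using assms that by (auto simp: proper_nth)
    then have "(\<forall>i\<le>w. (bit_kind b, T ! i, U ! i) \<notin> set (conflicts dec h r)) \<longleftrightarrow>
      (\<forall>i\<le>w. \<not> conflict dec h (bit_kind b, T ! i, U ! i))"
      by (simp add: conflict_set bit_kind_def)
    then show ?thesis
      using len
      by (auto simp: conflict_iff bit_kind_def start_def middle_def goal_def list_eq_iff_nth_eq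
          less_Suc_eq_le)
  qed
  then show ?thesis unfolding * by blast
qed

lemma triple_word:
  assumes "valid X" "valid Z" "valid Y"
  shows "\<exists>U. proper U \<and> start U = X \<and> middle U = Z \<and> goal U = Y"
proof -
  define U where "U = map (\<lambda>i. inv_into {..<r} dec (X ! i, Z ! i, Y ! i)) [0..<Suc w]"
  have mem: "(X ! i, Z ! i, Y ! i) \<in> dec ` {..<r}" if "i < Suc w" for i
  proof -
    have "(X ! i, Z ! i, Y ! i) \<in> S \<times> S \<times> S"
      using assms that by (auto simp: valid_word_def subset_eq)
    then show ?thesis using dec by (simp add: bij_betw_def)
  qed
  have len: "length X = Suc w" "length Z = Suc w" "length Y = Suc w"
    using assms by (auto simp: valid_word_def)
  have U: "start U = X" "middle U = Z" "goal U = Y"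
    unfolding start_def middle_def goal_def U_def
    by (rule nth_equalityI; use len in \<open>simp add: f_inv_into_f[OF mem] del: upt_Suc\<close>)+
  have "set U \<subseteq> {..<r}"
    unfolding U_def using inv_into_into[OF mem] by (auto simp del: upt_Suc)
  then have "proper U" using U assms by (simp add: proper_def) (simp add: U_def)
  then show ?thesis using U by blast
qed

abbreviation moves :: "('c list \<times> 'c list) set" where
  "moves \<equiv> word_moves w S h v"

definition final :: "nat \<Rightarrow> bool" where
  "final a \<longleftrightarrow> v (fst (dec a)) (snd (snd (dec a)))"

lemma moves_valid: "(X, Y) \<in> moves ^^ n \<Longrightarrow> 0 < n \<Longrightarrow> valid X \<and> valid Y"
proof -
  have "(X, Y) \<in> moves \<Longrightarrow> valid X \<and> valid Y" for X Y by (auto simp: word_moves_def)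
  then show "(X, Y) \<in> moves ^^ n \<Longrightarrow> 0 < n \<Longrightarrow> valid X \<and> valid Y"
    by (metis (no_types, lifting) gr0_conv_Suc relpow_Suc_D2 relpow_Suc_E)
qed

lemma proper_halves:
  "(\<exists>U. proper U \<and> start U = X \<and> goal U = Y \<and>
      (start U, middle U) \<in> moves ^^ (2 ^ m) \<and> (middle U, goal U) \<in> moves ^^ (2 ^ m)) \<longleftrightarrow>
   (X, Y) \<in> moves ^^ (2 ^ Suc m)"
proof -
  have "moves ^^ (2 ^ Suc m) = moves ^^ (2 ^ m) O moves ^^ (2 ^ m)"
    by (simp add: relpow_add mult_2)
  moreover have "\<exists>U. proper U \<and> start U = X \<and> goal U = Y \<and>
      (start U, middle U) \<in> moves ^^ (2 ^ m) \<and> (middle U, goal U) \<in> moves ^^ (2 ^ m)"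
    if Z: "(X, Z) \<in> moves ^^ (2 ^ m)" "(Z, Y) \<in> moves ^^ (2 ^ m)" for Z
  proof -
    have "valid X" "valid Z" "valid Y"
      using moves_valid[OF Z(1)] moves_valid[OF Z(2)] by auto
    from triple_word[OF this] show ?thesis using Z by blast
  qed
  ultimately show ?thesis by blast
qed

text \<open>The bit selects one of two pairs, and the middle track of the next block halves the
  distance again. After \<open>m\<close> halvings the last block restates a pair at distance one,
  which \<open>final\<close> compares cell by cell.\<close>

lemma wins_iff:
  assumes "proper U"
  shows "wins final m U \<longleftrightarrow> (start U, middle U) \<in> moves ^^ (2 ^ m) \<and> (middle U, goal U) \<in> moves ^^ (2 ^ m)"
  using assms
proof (induction m arbitrary: U)
  case 0
  have "(\<exists>V. proper V \<and> (\<forall>i\<le>w. (replicate (Suc w) final ! i) (V ! i)) \<and> start V = X \<and> goal V = Y) \<longleftrightarrow>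
      (X, Y) \<in> moves" if "valid X" "valid Y" for X Y
  proof -
    have "(\<forall>i\<le>w. (replicate (Suc w) final ! i) (V ! i)) \<longleftrightarrow> (\<forall>i\<le>w. v (start V ! i) (goal V ! i))"
      if "proper V" for V
      using that by (auto simp: final_def proper_def start_def goal_def less_Suc_eq_le simp del: replicate_Suc)
    \<comment> \<open>The last block has a middle track too, which need only be some valid word;
      \<open>X\<close> serves.\<close>
    then show ?thesis using triple_word[OF that(1) that(1) that(2)] that unfolding word_moves_def by auto
  qed
  from this[of "start U" "middle U"] this[of "middle U" "goal U"] show ?case
    using 0 by (auto simp: proper_def word_Some[OF 0] all_bool_eq)
next
  case (Suc m)
  have "\<forall>i\<le>w. (replicate (Suc w) (\<lambda>_. True) ! i) (V ! i)" for V :: "nat list"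
    by (simp add: nth_replicate less_Suc_eq_le del: replicate_Suc)
  then have "(\<exists>V. word (replicate (Suc w) (\<lambda>_. True)) (Some (U, b)) V \<and> wins final m V) \<longleftrightarrow>
     (\<exists>V. proper V \<and> start V = fst (if b then (start U, middle U) else (middle U, goal U)) \<and>
       goal V = snd (if b then (start U, middle U) else (middle U, goal U)) \<and>
       (start V, middle V) \<in> moves ^^ (2 ^ m) \<and> (middle V, goal V) \<in> moves ^^ (2 ^ m))" for b
    unfolding word_Some[OF Suc.prems] using Suc.IH by (cases b) auto
  then show ?case
    unfolding wins.simps proper_halves by (simp add: all_bool_eq)
qed

text \<open>The first block already halves the run, hence the exponent \<open>Suc m\<close>. Its
  symbols show both ends of the run at once, so \<open>A\<close> can restrict both in the first
  row.\<close>

theorem satisfiable_rounds: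
  assumes "infinite (UNIV :: 'w set)" "length als = Suc w"
    and als: "\<And>i a. i \<le> w \<Longrightarrow> (als ! i) a \<longleftrightarrow> A i (fst (dec a)) (snd (snd (dec a)))"
  shows "satisfiable TYPE('w) (formula (rounds m als final)) \<longleftrightarrow>
    (\<exists>X Y. (\<forall>i\<le>w. A i (X ! i) (Y ! i)) \<and> (X, Y) \<in> moves ^^ (2 ^ Suc m))"
proof -
  have "(\<forall>i\<le>w. (als ! i) (U ! i)) \<longleftrightarrow> (\<forall>i\<le>w. A i (start U ! i) (goal U ! i))" if "proper U" for U
    using that by (auto simp: als proper_def start_def goal_def)
  then have "(\<exists>U. word als None U \<and> wins final m U) \<longleftrightarrow>
      (\<exists>U. proper U \<and> (\<forall>i\<le>w. A i (start U ! i) (goal U ! i)) \<and>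
        (start U, middle U) \<in> moves ^^ (2 ^ m) \<and> (middle U, goal U) \<in> moves ^^ (2 ^ m))"
    unfolding word_None using wins_iff by (intro ex_cong1) blast
  also have "\<dots> \<longleftrightarrow> (\<exists>X Y. (\<forall>i\<le>w. A i (X ! i) (Y ! i)) \<and> (X, Y) \<in> moves ^^ (2 ^ Suc m))"
    unfolding proper_halves[symmetric] by blast
  finally show ?thesis
    using satisfiable_formula[OF assms(1)] game_rounds[OF assms(2)] by simp
qed

end

section \<open>Configurations as words\<close>

text \<open>Every cell knows the symbols under all heads, and hence, with the state, the whole transition.\<close>

type_synonym track = "nat \<times> nat \<times> bool \<times> bool \<times> bool"
type_synonym cell = "nat \<times> nat \<times> track list"

fun scanned :: "track \<Rightarrow> nat" where "scanned (g, s, l, c, r) = g"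
fun symbol :: "track \<Rightarrow> nat" where "symbol (g, s, l, c, r) = s"
fun head_left :: "track \<Rightarrow> bool" where "head_left (g, s, l, c, r) = l"
fun head_here :: "track \<Rightarrow> bool" where "head_here (g, s, l, c, r) = c"
fun head_right :: "track \<Rightarrow> bool" where "head_right (g, s, l, c, r) = r"

lemma track_eqI: "scanned t = scanned u \<Longrightarrow> symbol t = symbol u \<Longrightarrow> head_left t = head_left u \<Longrightarrow>
    head_here t = head_here u \<Longrightarrow> head_right t = head_right u \<Longrightarrow> t = u"
  by (cases t; cases u) simp

text \<open>At flag 0 a head that is told to move left stays; flag 1 marks the cell of the output bit; no head may
  come in from beyond flag 3.\<close>

definition flag :: "nat \<Rightarrow> nat \<Rightarrow> nat" where
  "flag w i = (if i = 0 then 0 else if i = 1 then 1 else if i = w then 3 else 2)"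

definition track_of :: "nat \<Rightarrow> tape \<Rightarrow> track" where
  "track_of i tp = (fst tp (snd tp), fst tp i, Suc (snd tp) = i, snd tp = i, snd tp = Suc i)"

lemma track_of_simps [simp]:
  "scanned (track_of i tp) = fst tp (snd tp)" "symbol (track_of i tp) = fst tp i"
  "head_left (track_of i tp) \<longleftrightarrow> Suc (snd tp) = i" "head_here (track_of i tp) \<longleftrightarrow> snd tp = i"
  "head_right (track_of i tp) \<longleftrightarrow> snd tp = Suc i"
  by (simp_all add: track_of_def)

definition config_word :: "nat \<Rightarrow> config \<Rightarrow> cell list" where
  "config_word w cfg = map (\<lambda>i. (flag w i, fst cfg, map (track_of i) (snd cfg))) [0..<Suc w]"

definition local_ok :: "cell \<Rightarrow> bool" where
  "local_ok = (\<lambda>(f, q, ts). \<forall>t \<in> set ts. (head_here t \<longrightarrow> scanned t = symbol t) \<and>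
     (f = 0 \<longrightarrow> \<not> head_left t) \<and> (f = 3 \<longrightarrow> \<not> head_right t))"

text \<open>Flags are not compared here: the first row fixes them and \<open>successor\<close>
  copies them from word to word.\<close>

definition adjacent :: "cell \<Rightarrow> cell \<Rightarrow> bool" where
  "adjacent = (\<lambda>(f, q, ts) (f', q', ts'). q = q' \<and> list_all2 (\<lambda>t u. scanned t = scanned u \<and>
     head_right t = head_here u \<and> head_left u = head_here t) ts ts')"

text \<open>Extended to the halting state by an idle action, so that \<open>step\<close> has one
  description in all states.\<close>

definition transition :: "machine \<Rightarrow> nat \<Rightarrow> nat list \<Rightarrow> nat \<times> (nat \<times> move) list" where
  "transition M q gs = (if q < length M then (M ! q) gs else (q, map (\<lambda>g. (g, Stay)) gs))"

primrec head_arrives :: "move \<Rightarrow> nat \<Rightarrow> track \<Rightarrow> bool" where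
  "head_arrives MoveLeft f t = (head_right t \<or> f = 0 \<and> head_here t)"
| "head_arrives Stay f t = head_here t"
| "head_arrives MoveRight f t = head_left t"

text \<open>Only the flag, the state, the symbol and the presence of a head are prescribed. The
  remaining components of the new cell follow from adjacency, so a cell is compared only with its
  own successor, which is all a binary constraint can do.\<close>

definition successor :: "machine \<Rightarrow> cell \<Rightarrow> cell \<Rightarrow> bool" where
  "successor M = (\<lambda>(f, q, ts) (f', q', ts'). f' = f \<and>
     q' = fst (transition M q (map scanned ts)) \<and> length ts' = length ts \<and>
     (\<forall>j < length ts. let (g, m) = snd (transition M q (map scanned ts)) ! j in
        symbol (ts' ! j) = (if head_here (ts ! j) then g else symbol (ts ! j)) \<and>
        head_here (ts' ! j) = head_arrives m f (ts ! j)))"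

definition cells :: "nat \<Rightarrow> nat \<Rightarrow> machine \<Rightarrow> cell set" where
  "cells k G M = {x \<in> {..3} \<times> {..length M} \<times> {ts. set ts \<subseteq> {..<G} \<times> {..<G} \<times> UNIV \<and> length ts = k}. local_ok x}"

lemma finite_cells: "finite (cells k G M)"
proof -
  have "finite {ts :: track list. set ts \<subseteq> {..<G} \<times> {..<G} \<times> UNIV \<and> length ts = k}"
    by (rule finite_lists_length_eq) simp
  then show ?thesis unfolding cells_def by (intro finite_Collect_conjI disjI1) simp
qed

locale space_bounded =
  fixes k G :: nat and M :: machine and w :: nat
  assumes M: "turing_machine k G M" and w: "2 \<le> w"
begin

definition inside :: "config \<Rightarrow> bool" where
  "inside cfg \<longleftrightarrow> fst cfg \<le> length M \<and> length (snd cfg) = k \<and>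
     (\<forall>tp \<in> set (snd cfg). range (fst tp) \<subseteq> {..<G} \<and> snd tp \<le> w)"

lemma config_word_nth: "i \<le> w \<Longrightarrow>
    config_word w cfg ! i = (flag w i, fst cfg, map (track_of i) (snd cfg))"
  unfolding config_word_def by (simp del: upt_Suc add: less_Suc_eq_le)

lemma valid_config_word:
  assumes "inside cfg"
  shows "valid_word w (cells k G M) adjacent (config_word w cfg)"
proof -
  have "(flag w i, fst cfg, map (track_of i) (snd cfg)) \<in> cells k G M" if "i \<le> w" for i
    using assms that w unfolding cells_def inside_def local_ok_def
    by (auto simp: track_of_def flag_def subset_eq split: if_splits)
  then have "set (config_word w cfg) \<subseteq> cells k G M"
    unfolding config_word_def by (auto simp: less_Suc_eq_le simp del: upt_Suc)
  moreover have "adjacent (config_word w cfg ! i) (config_word w cfg ! Suc i)" if "i < w" for i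
    using that by (simp add: config_word_nth adjacent_def list_all2_conv_all_nth)
  ultimately show ?thesis
    by (simp add: valid_word_def) (simp add: config_word_def)
qed

lemma step_transition:
  "step M cfg = (fst (transition M (fst cfg) (map read (snd cfg))),
     map2 act (snd (transition M (fst cfg) (map read (snd cfg)))) (snd cfg))"
proof (cases cfg)
  case (Pair q tps)
  have "act (read tp, Stay) tp = tp" for tp by (cases tp) auto
  then have "map2 act (map (\<lambda>g. (g, Stay)) (map read tps)) tps = tps"
    by (induction tps) auto
  then show ?thesis by (auto simp: Pair transition_def case_prod_beta)
qed

lemma read_scanned: "map scanned (map (track_of i) tps) = map read tps"
  by (auto simp: track_of_def split: prod.splits)

lemma transition_length:
  assumes "inside cfg"
  shows "length (snd (transition M (fst cfg) (map read (snd cfg)))) = k"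
    "fst (transition M (fst cfg) (map read (snd cfg))) \<le> length M"
    "fst ` set (snd (transition M (fst cfg) (map read (snd cfg)))) \<subseteq> {..<G}"
proof -
  let ?gs = "map read (snd cfg)"
  have gs: "length ?gs = k" "set ?gs \<subseteq> {..<G}"
    using assms unfolding inside_def by (auto simp: subset_eq)
  have "M ! fst cfg \<in> set M" if "fst cfg < length M" using that by simp
  then have "fst cfg < length M \<Longrightarrow> fst ((M ! fst cfg) ?gs) \<le> length M \<and> length (snd ((M ! fst cfg) ?gs)) = k \<and>
      fst ` set (snd ((M ! fst cfg) ?gs)) \<subseteq> {..<G}"
    using M gs unfolding turing_machine_def by blast
  then show "length (snd (transition M (fst cfg) (map read (snd cfg)))) = k"
    "fst (transition M (fst cfg) (map read (snd cfg))) \<le> length M"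
    "fst ` set (snd (transition M (fst cfg) (map read (snd cfg)))) \<subseteq> {..<G}"
    using gs assms unfolding transition_def inside_def by (auto simp: image_subset_iff)
qed

lemma successor_step:
  assumes "inside cfg" "i \<le> w"
  shows "successor M (config_word w cfg ! i) (config_word w (step M cfg) ! i)"
proof -
  let ?t = "transition M (fst cfg) (map read (snd cfg))"
  have len: "length (snd ?t) = length (snd cfg)"
    using transition_length(1)[OF assms(1)] assms(1) by (simp add: inside_def)
  have "let (g, m) = snd ?t ! j in
      symbol (track_of i (act (snd ?t ! j) (snd cfg ! j))) =
        (if snd (snd cfg ! j) = i then g else fst (snd cfg ! j) i) \<and>
      (snd (act (snd ?t ! j) (snd cfg ! j)) = i) = head_arrives m (flag w i) (track_of i (snd cfg ! j))"
    if "j < length (snd cfg)" for j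
  proof -
    obtain g m c p where gm: "snd ?t ! j = (g, m)" and cp: "snd cfg ! j = (c, p)" by fastforce
    show ?thesis unfolding gm cp by (cases m) (auto simp: flag_def)
  qed
  then show ?thesis
    unfolding config_word_nth[OF assms(2)] successor_def prod.case read_scanned step_transition fst_conv snd_conv
    using len by (simp add: Let_def case_prod_beta)
qed

text \<open>The positions of the heads and the symbols under them are spread by adjacency, so a word is
  determined by its states, its symbols and the cells that carry a head.\<close>

lemma valid_word_eqI:
  assumes X: "valid_word w (cells k G M) adjacent X" and Y: "valid_word w (cells k G M) adjacent Y"
    and fl: "\<And>i. i \<le> w \<Longrightarrow> fst (X ! i) = flag w i" "\<And>i. i \<le> w \<Longrightarrow> fst (Y ! i) = flag w i"
    and st: "\<And>i. i \<le> w \<Longrightarrow> fst (snd (X ! i)) = fst (snd (Y ! i))"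
    and sy: "\<And>i j. i \<le> w \<Longrightarrow> j < k \<Longrightarrow> symbol (snd (snd (X ! i)) ! j) = symbol (snd (snd (Y ! i)) ! j)"
    and he: "\<And>i j. i \<le> w \<Longrightarrow> j < k \<Longrightarrow> head_here (snd (snd (X ! i)) ! j) = head_here (snd (snd (Y ! i)) ! j)"
    and ex: "\<And>j. j < k \<Longrightarrow> \<exists>i\<le>w. head_here (snd (snd (Y ! i)) ! j)"
  shows "X = Y"
proof -
  have mem: "Z ! i \<in> cells k G M" if "valid_word w (cells k G M) adjacent Z" "i \<le> w" for Z i
    using that unfolding valid_word_def by (auto simp: subset_eq)
  have len: "length (snd (snd (Z ! i))) = k" if "valid_word w (cells k G M) adjacent Z" "i \<le> w" for Z i
    using mem[OF that] by (auto simp: cells_def)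
  have ok: "(head_here (snd (snd (Z ! i)) ! j) \<longrightarrow> scanned (snd (snd (Z ! i)) ! j) = symbol (snd (snd (Z ! i)) ! j)) \<and>
      (i = 0 \<longrightarrow> \<not> head_left (snd (snd (Z ! i)) ! j)) \<and> (i = w \<longrightarrow> \<not> head_right (snd (snd (Z ! i)) ! j))"
    if "valid_word w (cells k G M) adjacent Z" "i \<le> w" "j < k" "fst (Z ! i) = flag w i" for Z i j
  proof -
    have "local_ok (Z ! i)" using mem[OF that(1,2)] by (simp add: cells_def)
    moreover have "snd (snd (Z ! i)) ! j \<in> set (snd (snd (Z ! i)))" using len[OF that(1,2)] that(3) by simp
    ultimately show ?thesis
      using that(4) w unfolding local_ok_def by (auto simp: case_prod_beta flag_def)
  qed
  have adj: "scanned (snd (snd (Z ! i)) ! j) = scanned (snd (snd (Z ! Suc i)) ! j) \<and>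
      head_right (snd (snd (Z ! i)) ! j) = head_here (snd (snd (Z ! Suc i)) ! j) \<and>
      head_left (snd (snd (Z ! Suc i)) ! j) = head_here (snd (snd (Z ! i)) ! j)"
    if "valid_word w (cells k G M) adjacent Z" "i < w" "j < k" for Z i j
  proof -
    have "adjacent (Z ! i) (Z ! Suc i)" using that by (simp add: valid_word_def)
    then show ?thesis
      using len[OF that(1), of i] that unfolding adjacent_def
      by (auto simp: case_prod_beta list_all2_conv_all_nth)
  qed
  have const: "scanned (snd (snd (Z ! i)) ! j) = scanned (snd (snd (Z ! 0)) ! j)"
    if "valid_word w (cells k G M) adjacent Z" "i \<le> w" "j < k" for Z i j
    using that(2) by (induction i) (use adj[OF that(1) _ that(3)] in \<open>auto simp: Suc_le_eq\<close>)
  have "X ! i = Y ! i" if i: "i \<le> w" for i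
  proof -
    have "snd (snd (X ! i)) ! j = snd (snd (Y ! i)) ! j" if j: "j < k" for j
    proof (rule track_eqI)
      show "symbol (snd (snd (X ! i)) ! j) = symbol (snd (snd (Y ! i)) ! j)"
        "head_here (snd (snd (X ! i)) ! j) = head_here (snd (snd (Y ! i)) ! j)"
        using sy he i j by auto
      show "head_left (snd (snd (X ! i)) ! j) = head_left (snd (snd (Y ! i)) ! j)"
      proof (cases i)
        case 0
        then show ?thesis using ok[OF X i j fl(1)[OF i]] ok[OF Y i j fl(2)[OF i]] by simp
      next
        case (Suc p)
        then show ?thesis using adj[OF X _ j, of p] adj[OF Y _ j, of p] he[OF _ j, of p] i by simp
      qed
      show "head_right (snd (snd (X ! i)) ! j) = head_right (snd (snd (Y ! i)) ! j)"
      proof (cases "i = w")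
        case True
        then show ?thesis using ok[OF X i j fl(1)[OF i]] ok[OF Y i j fl(2)[OF i]] by simp
      next
        case False
        then show ?thesis using adj[OF X _ j, of i] adj[OF Y _ j, of i] he[OF _ j, of "Suc i"] i by simp
      qed
      obtain p where p: "p \<le> w" "head_here (snd (snd (Y ! p)) ! j)" using ex[OF j] by blast
      have "scanned (snd (snd (X ! p)) ! j) = scanned (snd (snd (Y ! p)) ! j)"
        using ok[OF X p(1) j fl(1)[OF p(1)]] ok[OF Y p(1) j fl(2)[OF p(1)]] p he[OF p(1) j] sy[OF p(1) j] by simp
      then show "scanned (snd (snd (X ! i)) ! j) = scanned (snd (snd (Y ! i)) ! j)"
        using const[OF X i j] const[OF X p(1) j] const[OF Y i j] const[OF Y p(1) j] by simp
    qed
    then have "snd (snd (X ! i)) = snd (snd (Y ! i))"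
      using len[OF X i] len[OF Y i] by (intro nth_equalityI) auto
    then show ?thesis using fl[OF i] st[OF i] by (simp add: prod_eq_iff)
  qed
  moreover have "length X = Suc w" "length Y = Suc w" using X Y by (auto simp: valid_word_def)
  ultimately show ?thesis by (intro nth_equalityI) auto
qed

lemma successor_unique:
  assumes cfg: "inside cfg" "inside (step M cfg)" and Y: "valid_word w (cells k G M) adjacent Y"
    and suc: "\<And>i. i \<le> w \<Longrightarrow> successor M (config_word w cfg ! i) (Y ! i)"
  shows "Y = config_word w (step M cfg)"
proof (rule valid_word_eqI[OF Y valid_config_word[OF cfg(2)]])
  note suc' = successor_step[OF cfg(1)]
  have len: "length (snd cfg) = k" "length (snd (step M cfg)) = k" using cfg by (auto simp: inside_def)
  show "fst (Y ! i) = flag w i" if "i \<le> w" for i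
    using suc[OF that] that by (auto simp: successor_def config_word_nth case_prod_beta)
  show "fst (config_word w (step M cfg) ! i) = flag w i" if "i \<le> w" for i
    using that by (simp add: config_word_nth)
  show "fst (snd (Y ! i)) = fst (snd (config_word w (step M cfg) ! i))" if "i \<le> w" for i
    using suc[OF that] suc'[OF that] by (auto simp: successor_def case_prod_beta)
  show "symbol (snd (snd (Y ! i)) ! j) = symbol (snd (snd (config_word w (step M cfg) ! i)) ! j)"
    "head_here (snd (snd (Y ! i)) ! j) = head_here (snd (snd (config_word w (step M cfg) ! i)) ! j)"
    if "i \<le> w" "j < k" for i j
  proof -
    have "length (snd (snd (config_word w cfg ! i))) = k" using len that by (simp add: config_word_nth)
    then show "symbol (snd (snd (Y ! i)) ! j) = symbol (snd (snd (config_word w (step M cfg) ! i)) ! j)"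
      "head_here (snd (snd (Y ! i)) ! j) = head_here (snd (snd (config_word w (step M cfg) ! i)) ! j)"
      using suc[OF that(1)] suc'[OF that(1)] that(2) unfolding successor_def Let_def case_prod_beta by metis+
  qed
  show "\<exists>i\<le>w. head_here (snd (snd (config_word w (step M cfg) ! i)) ! j)" if "j < k" for j
    using cfg(2) that len
    by (intro exI[of _ "snd (snd (step M cfg) ! j)"]) (auto simp: inside_def config_word_nth)
qed

end

section \<open>Start, acceptance and the number of steps\<close>

text \<open>All heads start on cell 0, which holds 1 on every tape. Hence the flag and the input
  symbol \<open>g\<close> determine the cell, and a row of such cells can be printed while reading
  the input.\<close>

definition initial_cell :: "nat \<Rightarrow> nat \<Rightarrow> nat \<Rightarrow> cell" where
  "initial_cell k f g =
     (f, 0, map (\<lambda>j. (1, if j = 0 then g else if f = 0 then 1 else 0, f = 1, f = 0, False)) [0..<k])"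

definition accepting :: "machine \<Rightarrow> cell \<Rightarrow> bool" where
  "accepting M = (\<lambda>(f, q, ts). q = length M \<and> (f = 1 \<longrightarrow> symbol (last ts) = 3))"

lemma step_halted: "fst cfg = length M \<Longrightarrow> (step M ^^ n) cfg = cfg"
  by (induction n) (cases cfg; auto)+

lemma run_Suc: "run M k x (Suc t) = step M (run M k x t)"
  by (simp add: run_def)

lemma run_add: "run M k x (s + t) = (step M ^^ t) (run M k x s)"
  unfolding run_def by (metis add.commute comp_apply funpow_add)

context space_bounded
begin

lemma inside_init: "inside (init k x)"
proof -
  have "fst (tape_of y) i < G" for y i
  proof -
    have "bit_symbol b < 4" for b by (cases b) auto
    then have "fst (tape_of y) i < 4" by (simp add: tape_of_def)
    then show ?thesis using M by (simp add: turing_machine_def)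
  qed
  then have "range (fst (tape_of y)) \<subseteq> {..<G}" for y by blast
  moreover have "snd (tape_of y) = 0" for y by (simp add: tape_of_def)
  moreover have "1 \<le> k" using M by (simp add: turing_machine_def)
  ultimately show ?thesis unfolding inside_def init_def by auto
qed

lemma inside_step:
  assumes "inside cfg" "\<And>tp. tp \<in> set (snd (step M cfg)) \<Longrightarrow> snd tp \<le> w"
  shows "inside (step M cfg)"
proof -
  let ?t = "transition M (fst cfg) (map read (snd cfg))"
  note t = transition_length[OF assms(1)]
  have act: "range (fst (act a tp)) \<subseteq> {..<G}" if "a \<in> set (snd ?t)" "tp \<in> set (snd cfg)" for a tp
  proof -
    have "range (fst tp) \<subseteq> {..<G}" "fst a < G"
      using that assms(1) t(3) by (auto simp: inside_def subset_eq)
    then show ?thesis by (cases a; cases tp) auto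
  qed
  then have "range (fst tp) \<subseteq> {..<G}" if "tp \<in> set (snd (step M cfg))" for tp
  proof -
    obtain a u where "(a, u) \<in> set (zip (snd ?t) (snd cfg))" "tp = act a u"
      using \<open>tp \<in> _\<close> unfolding step_transition by auto
    then show ?thesis
      using act by (blast dest: set_zip_leftD set_zip_rightD)
  qed
  then show ?thesis
    using assms t unfolding inside_def by (auto simp: step_transition)
qed

lemma config_word_init:
  assumes "i \<le> w"
  shows "config_word w (init k x) ! i = initial_cell k (flag w i) (fst (tape_of x) i)"
proof -
  have "map (track_of i) (snd (init k x)) =
      map (\<lambda>j. (1, if j = 0 then fst (tape_of x) i else if flag w i = 0 then 1 else 0,
        flag w i = 1, flag w i = 0, False)) [0..<k]"
  proof (rule nth_equalityI)
    have "1 \<le> k" using M by (simp add: turing_machine_def)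
    then show "length (map (track_of i) (snd (init k x))) = length (map (\<lambda>j. (1, if j = 0 then fst (tape_of x) i
        else if flag w i = 0 then 1 else 0, flag w i = 1, flag w i = 0, False)) [0..<k])"
      by (simp add: init_def)
    fix j assume "j < length (map (track_of i) (snd (init k x)))"
    then have j: "j < k" using \<open>1 \<le> k\<close> by (simp add: init_def)
    show "map (track_of i) (snd (init k x)) ! j = map (\<lambda>j. (1, if j = 0 then fst (tape_of x) i
        else if flag w i = 0 then 1 else 0, flag w i = 1, flag w i = 0, False)) [0..<k] ! j"
      using j by (cases j) (auto simp: init_def track_of_def tape_of_def flag_def)
  qed
  then show ?thesis
    using assms by (simp add: config_word_nth initial_cell_def) (simp add: init_def)
qed

context
  fixes x
  assumes space: "\<And>t tp. tp \<in> set (snd (run M k x t)) \<Longrightarrow> snd tp \<le> w"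
begin

lemma inside_run: "inside (run M k x t)"
proof (induction t)
  case 0
  then show ?case by (simp add: run_def inside_init)
next
  case (Suc t)
  then show ?case using inside_step[of "run M k x t"] space[of _ "Suc t"] by (simp add: run_def)
qed

text \<open>From a word of the run the relation allows only one continuation, by
  \<open>successor_unique\<close>, so its powers trace the run.\<close>

lemma moves_run:
  "(config_word w (run M k x t), Y) \<in> word_moves w (cells k G M) adjacent (successor M) ^^ n \<longleftrightarrow>
     Y = config_word w (run M k x (t + n))"
proof (induction n arbitrary: Y)
  case (Suc n)
  let ?c = "run M k x (t + n)"
  have c: "inside ?c" "inside (step M ?c)" "run M k x (t + Suc n) = step M ?c"
    using inside_run[of "t + n"] inside_run[of "Suc (t + n)"] unfolding add_Suc_right run_Suc by blast+
  have "(config_word w ?c, Y) \<in> word_moves w (cells k G M) adjacent (successor M) \<longleftrightarrow>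
      Y = config_word w (step M ?c)" for Y
  proof
    assume "(config_word w ?c, Y) \<in> word_moves w (cells k G M) adjacent (successor M)"
    then show "Y = config_word w (step M ?c)"
      unfolding word_moves_def by (intro successor_unique[OF c(1,2)]) blast+
  next
    assume Y: "Y = config_word w (step M ?c)"
    show "(config_word w ?c, Y) \<in> word_moves w (cells k G M) adjacent (successor M)"
      unfolding word_moves_def Y
      using successor_step[OF c(1)] valid_config_word[OF c(1)] valid_config_word[OF c(2)] by blast
  qed
  moreover have "(config_word w (run M k x t), Y) \<in> word_moves w (cells k G M) adjacent (successor M) ^^ Suc n \<longleftrightarrow>
     (config_word w ?c, Y) \<in> word_moves w (cells k G M) adjacent (successor M)"
    unfolding relpow.simps relcomp_unfold mem_Collect_eq case_prod_conv using Suc by simp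
  ultimately show ?case unfolding c(3) by simp
qed auto

text \<open>Words rather than configurations are counted, since there are finitely many. Up to the
  first halting time they are distinct: equal words have equal futures by \<open>moves_run\<close>,
  so a repetition would bring halting forward.\<close>

lemma halting_time:
  assumes "fst (run M k x t) = length M"
  shows "\<exists>s < card (cells k G M) ^ Suc w. fst (run M k x s) = length M \<and> run M k x s = run M k x t"
proof -
  define s where "s = (LEAST s. fst (run M k x s) = length M)"
  have s: "fst (run M k x s) = length M" "s \<le> t"
    unfolding s_def using assms by (auto intro: LeastI Least_le)
  have eq: "run M k x t = run M k x s"
    using run_add[of M k x s "t - s"] s step_halted by simp
  have inj: "inj_on (\<lambda>i. config_word w (run M k x i)) {..s}"
  proof (rule linorder_inj_onI)
    fix a b assume ab: "a < b" "a \<in> {..s}" "b \<in> {..s}"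
    show "config_word w (run M k x a) \<noteq> config_word w (run M k x b)"
    proof
      assume e: "config_word w (run M k x a) = config_word w (run M k x b)"
      have "config_word w (run M k x (a + (s - b))) = config_word w (run M k x (b + (s - b)))"
        using moves_run[of a _ "s - b"] moves_run[of b _ "s - b"] unfolding e by blast
      then have "config_word w (run M k x (a + (s - b))) ! 0 = config_word w (run M k x s) ! 0"
        using ab by simp
      then have "fst (run M k x (a + (s - b))) = length M"
        using s(1) by (simp add: config_word_nth)
      then have "s \<le> a + (s - b)" unfolding s_def by (rule Least_le)
      then show False using ab by auto
    qed
  qed auto
  let ?W = "{X. set X \<subseteq> cells k G M \<and> length X = Suc w}"
  have "card ((\<lambda>i. config_word w (run M k x i)) ` {..s}) \<le> card ?W"
  proof (rule card_mono)
    show "finite ?W" by (rule finite_lists_length_eq[OF finite_cells])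
    show "(\<lambda>i. config_word w (run M k x i)) ` {..s} \<subseteq> ?W"
      using valid_config_word[OF inside_run] by (auto simp: valid_word_def)
  qed
  then have "s < card (cells k G M) ^ Suc w"
    using inj by (simp add: card_image card_lists_length_eq[OF finite_cells])
  then show ?thesis using s eq by auto
qed

text \<open>A halted machine keeps its configuration, so one may ask for exactly
  \<open>2 ^ m\<close> moves instead of a bounded number.\<close>

theorem run_moves:
  assumes halts: "halts_with_output M (run M k x t) [acc]"
    and m: "card (cells k G M) ^ Suc w \<le> 2 ^ m"
  shows "acc \<longleftrightarrow> (\<exists>X Y. (\<forall>i\<le>w. X ! i = initial_cell k (flag w i) (fst (tape_of x) i) \<and> accepting M (Y ! i)) \<and>
     (X, Y) \<in> word_moves w (cells k G M) adjacent (successor M) ^^ (2 ^ m))"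
proof -
  let ?R = "word_moves w (cells k G M) adjacent (successor M)"
  let ?Y = "config_word w (run M k x (2 ^ m))"
  obtain s where s: "s < 2 ^ m" "fst (run M k x s) = length M" "run M k x s = run M k x t"
    using halting_time halts m unfolding halts_with_output_def by (metis order_less_le_trans)
  have "run M k x (2 ^ m) = run M k x t"
    using run_add[of M k x s "2 ^ m - s"] s step_halted by simp
  then have Y: "fst (run M k x (2 ^ m)) = length M" "fst (last (snd (run M k x (2 ^ m)))) 1 = bit_symbol acc"
    using halts unfolding halts_with_output_def by auto
  have ne: "snd (run M k x (2 ^ m)) \<noteq> []"
    using inside_run[of "2 ^ m"] M by (auto simp: inside_def turing_machine_def)
  have start: "X = config_word w (run M k x 0)"
    if "(X, Y) \<in> ?R ^^ (2 ^ m)" "\<forall>i\<le>w. X ! i = initial_cell k (flag w i) (fst (tape_of x) i)" for X Y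
  proof (rule nth_equalityI)
    obtain n where "2 ^ m = Suc n" using not0_implies_Suc[of "2 ^ m :: nat"] by auto
    then have "(X, Y) \<in> ?R ^^ Suc n" using that(1) by simp
    then obtain Z where "(X, Z) \<in> ?R" by (blast dest: relpow_Suc_D2)
    then show len: "length X = length (config_word w (run M k x 0))"
      by (simp add: word_moves_def valid_word_def config_word_def)
    show "X ! i = config_word w (run M k x 0) ! i" if "i < length X" for i
      using that len \<open>\<forall>i\<le>w. _\<close> config_word_init[of i x] by (simp add: run_def) (simp add: config_word_def)
  qed
  have init: "\<forall>i\<le>w. config_word w (run M k x 0) ! i = initial_cell k (flag w i) (fst (tape_of x) i)"
    by (simp add: run_def config_word_init)
  have "(\<exists>X Y. (\<forall>i\<le>w. X ! i = initial_cell k (flag w i) (fst (tape_of x) i) \<and> accepting M (Y ! i)) \<and>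
     (X, Y) \<in> ?R ^^ (2 ^ m)) \<longleftrightarrow> (\<forall>i\<le>w. accepting M (?Y ! i))" (is "?L \<longleftrightarrow> _")
  proof
    assume ?L
    then obtain X Y where XY: "\<forall>i\<le>w. X ! i = initial_cell k (flag w i) (fst (tape_of x) i)"
      "\<forall>i\<le>w. accepting M (Y ! i)" "(X, Y) \<in> ?R ^^ (2 ^ m)" by blast
    have "Y = ?Y" using XY(3) moves_run[of 0 Y "2 ^ m"] unfolding start[OF XY(3,1)] by simp
    then show "\<forall>i\<le>w. accepting M (?Y ! i)" using XY(2) by simp
  next
    assume "\<forall>i\<le>w. accepting M (?Y ! i)"
    moreover have "(config_word w (run M k x 0), ?Y) \<in> ?R ^^ (2 ^ m)"
      using moves_run[of 0 ?Y "2 ^ m"] by simp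
    ultimately show ?L using init by blast
  qed
  also have "\<dots> \<longleftrightarrow> acc"
  proof -
    have "accepting M (?Y ! i) \<longleftrightarrow> (i = 1 \<longrightarrow> acc)" if "i \<le> w" for i
      using Y ne that w by (cases acc) (auto simp: config_word_nth accepting_def flag_def last_map)
    then show ?thesis using w by auto
  qed
  finally show ?thesis by simp
qed

end

end

section \<open>A language of nested loops\<close>

text \<open>Programs write bits and loop; every loop runs the same number of times. The input tape is read only,
  and a bit may depend on the symbol that is being read. The loop counters are the head positions of further
  tapes, one for each nesting depth.\<close>

datatype prog = Skip | Out "nat \<Rightarrow> bool" | Advance | Seq prog prog | Loop prog

primrec eval :: "(nat \<Rightarrow> nat) \<Rightarrow> nat \<Rightarrow> prog \<Rightarrow> bool list \<times> nat \<Rightarrow> bool list \<times> nat" where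
  "eval c B Skip = id"
| "eval c B (Out f) = (\<lambda>(ys, h). (ys @ [f (c h)], h))"
| "eval c B Advance = (\<lambda>(ys, h). (ys, Suc h))"
| "eval c B (Seq P Q) = eval c B Q \<circ> eval c B P"
| "eval c B (Loop P) = eval c B P ^^ B"

primrec depth :: "prog \<Rightarrow> nat" where
  "depth Skip = 0"
| "depth (Out f) = 0"
| "depth Advance = 0"
| "depth (Seq P Q) = max (depth P) (depth Q)"
| "depth (Loop P) = Suc (depth P)"

primrec states :: "prog \<Rightarrow> nat" where
  "states Skip = 0"
| "states (Out f) = 1"
| "states Advance = 1"
| "states (Seq P Q) = states P + states Q"
| "states (Loop P) = states P + 3"

text \<open>In a loop each iteration costs the body, a test and a step of the counter. Leaving it
  costs one more test, as many moves back as there were iterations, and the step that recognises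
  cell 0.\<close>

primrec time :: "prog \<Rightarrow> nat poly" where
  "time Skip = 0"
| "time (Out f) = 1"
| "time Advance = 1"
| "time (Seq P Q) = time P + time Q"
| "time (Loop P) = [:0, 1:] * (time P + 2) + [:2, 1:]"

definition transit :: "nat \<Rightarrow> (nat list \<Rightarrow> nat) \<Rightarrow> (nat list \<Rightarrow> nat \<Rightarrow> nat \<times> move) \<Rightarrow> nat list \<Rightarrow> nat \<times> (nat \<times> move) list" where
  "transit K nxt A gs = (nxt gs, map (A gs) [0..<Suc K])"

text \<open>Tape 0 is the input, tape \<open>K\<close> the output. A loop tape has the symbol 1 in cell 0 and
  the symbol 2 in the cell whose number is the number of iterations.\<close>

primrec compile :: "nat \<Rightarrow> nat \<Rightarrow> prog \<Rightarrow> machine" where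
  "compile K s Skip = []"
| "compile K s (Out f) = [transit K (\<lambda>_. Suc s) (\<lambda>gs j. if j = K then (bit_symbol (f (gs ! 0)), MoveRight) else (gs ! j, Stay))]"
| "compile K s Advance = [transit K (\<lambda>_. Suc s) (\<lambda>gs j. (gs ! j, if j = 0 then MoveRight else Stay))]"
| "compile K s (Seq P Q) = compile K s P @ compile K (s + states P) Q"
| "compile K s (Loop P) =
     transit K (\<lambda>gs. if gs ! Suc (depth P) = 2 then s + states P + 2 else Suc s) (\<lambda>gs j. (gs ! j, Stay)) #
     compile K (Suc s) P @
     [transit K (\<lambda>_. s) (\<lambda>gs j. (gs ! j, if j = Suc (depth P) then MoveRight else Stay)),
      transit K (\<lambda>gs. if gs ! Suc (depth P) = 1 then s + states P + 3 else s + states P + 2)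
        (\<lambda>gs j. (gs ! j, if j = Suc (depth P) \<and> gs ! j \<noteq> 1 then MoveLeft else Stay))]"

lemma length_compile [simp]: "length (compile K s P) = states P"
  by (induction P arbitrary: s) auto

text \<open>The loop tapes share their contents \<open>L\<close> and differ in their head positions
  only.\<close>

definition conf :: "nat \<Rightarrow> nat \<Rightarrow> tape \<Rightarrow> (nat \<Rightarrow> nat) \<Rightarrow> (nat \<Rightarrow> nat) \<Rightarrow> tape \<Rightarrow> config" where
  "conf K q inp L pos out =
     (q, map (\<lambda>j. if j = 0 then inp else if j = K then out else (L, pos j)) [0..<Suc K])"

lemma step_conf:
  assumes "q < length M" "M ! q = transit K nxt A"
    and gs: "gs = map read (snd (conf K q inp L pos out))"
  shows "step M (conf K q inp L pos out) =
    (nxt gs, map (\<lambda>j. act (A gs j) (if j = 0 then inp else if j = K then out else (L, pos j))) [0..<Suc K])"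
proof -
  have "map2 act (map f xs) (map g xs) = map (\<lambda>j. act (f j) (g j)) xs" for f g and xs :: "nat list"
    by (induction xs) auto
  then show ?thesis
    using assms(1,2) unfolding gs conf_def transit_def by (simp del: upt_Suc)
qed

lemma read_conf:
  assumes "0 < K" "j \<le> K"
  shows "map read (snd (conf K q inp L pos out)) ! j =
    (if j = 0 then read inp else if j = K then read out else L (pos j))"
  using assms unfolding conf_def by (simp del: upt_Suc add: less_Suc_eq_le)

lemma step_conf_eq:
  assumes "q < length M" "M ! q = transit K nxt A" "0 < K"
    and "nxt (map read (snd (conf K q inp L pos out))) = q'"
    and "act (A (map read (snd (conf K q inp L pos out))) 0) inp = inp'"
    and "act (A (map read (snd (conf K q inp L pos out))) K) out = out'"
    and "\<And>j. 0 < j \<Longrightarrow> j < K \<Longrightarrow> act (A (map read (snd (conf K q inp L pos out))) j) (L, pos j) = (L', pos' j)"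
  shows "step M (conf K q inp L pos out) = conf K q' inp' L' pos' out'"
  unfolding step_conf[OF assms(1,2) refl] using assms(3-)
  by (auto simp: conf_def simp del: upt_Suc)

lemma act_stay: "act (read tp, Stay) tp = tp"
  by (cases tp) simp

definition loop_tape :: "nat \<Rightarrow> nat \<Rightarrow> nat" where
  "loop_tape B i = (if i = 0 then 1 else if i = B then 2 else 0)"

definition output_tape :: "bool list \<Rightarrow> tape" where
  "output_tape ys = (fst (tape_of ys), Suc (length ys))"

lemma write_output: "act (bit_symbol b, MoveRight) (output_tape ys) = output_tape (ys @ [b])"
  by (auto simp: output_tape_def tape_of_def nth_append fun_eq_iff)

definition loaded :: "machine \<Rightarrow> nat \<Rightarrow> machine \<Rightarrow> bool" where
  "loaded M s C \<longleftrightarrow> s + length C \<le> length M \<and> (\<forall>i < length C. M ! (s + i) = C ! i)"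

lemma loaded_append: "loaded M s (C @ D) \<longleftrightarrow> loaded M s C \<and> loaded M (s + length C) D"
proof
  assume l: "loaded M s (C @ D)"
  have "M ! (s + length C + i) = D ! i" if "i < length D" for i
    using l that unfolding loaded_def by (auto simp: nth_append add.assoc dest!: spec[of _ "length C + i"])
  then show "loaded M s C \<and> loaded M (s + length C) D"
    using l unfolding loaded_def by (auto simp: nth_append)
next
  assume l: "loaded M s C \<and> loaded M (s + length C) D"
  have "M ! (s + i) = (C @ D) ! i" if i: "i < length (C @ D)" for i
  proof (cases "i < length C")
    case False
    then obtain p where "i = length C + p" by (metis le_Suc_ex not_less)
    then show ?thesis using l i unfolding loaded_def by (simp add: nth_append add.assoc)
  qed (use l in \<open>auto simp: loaded_def nth_append\<close>)
  then show "loaded M s (C @ D)" using l unfolding loaded_def by auto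
qed

lemma loaded_Cons: "loaded M s (\<delta> # C) \<longleftrightarrow> s < length M \<and> M ! s = \<delta> \<and> loaded M (Suc s) C"
proof -
  have "loaded M s [\<delta>] \<longleftrightarrow> s < length M \<and> M ! s = \<delta>" by (auto simp: loaded_def)
  then show ?thesis using loaded_append[of M s "[\<delta>]" C] by simp
qed

lemma funpow_trans:
  assumes "(f ^^ s) x = y" "(f ^^ t) y = z"
  shows "(f ^^ (s + t)) x = z"
  using assms by (metis add.commute comp_apply funpow_add)

definition steps_to :: "machine \<Rightarrow> nat \<Rightarrow> config \<Rightarrow> config \<Rightarrow> bool" where
  "steps_to M n x y \<longleftrightarrow> (\<exists>t\<le>n. (step M ^^ t) x = y)"

lemma steps_to_refl: "steps_to M n x x"
  unfolding steps_to_def by (intro exI[of _ 0]) simp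

lemma steps_to_step: "step M x = y \<Longrightarrow> steps_to M 1 x y"
  unfolding steps_to_def by (intro exI[of _ 1]) simp

lemma steps_to_trans: "steps_to M m x y \<Longrightarrow> steps_to M n y z \<Longrightarrow> steps_to M (m + n) x z"
  unfolding steps_to_def using funpow_trans by (metis add_mono)

lemma steps_to_mono: "steps_to M m x y \<Longrightarrow> m \<le> n \<Longrightarrow> steps_to M n x y"
  unfolding steps_to_def using le_trans by blast

lemma steps_to_iterate:
  assumes "\<And>i. i < n \<Longrightarrow> steps_to M m (x i) (x (Suc i))"
  shows "steps_to M (n * m) (x 0) (x n)"
  using assms
proof (induction n)
  case (Suc n)
  then show ?case using steps_to_trans[of M "n * m" "x 0" "x n" m "x (Suc n)"] by (simp add: add.commute)
qed (simp add: steps_to_refl)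

text \<open>The loop around \<open>P\<close> counts on tape \<open>Suc (depth P)\<close>, while the
  loops inside \<open>P\<close> use lower tapes, so the counter survives the body. Each loop returns
  its head to cell 0, so loops of equal depth can share a tape.\<close>

lemma compile_correct:
  assumes "loaded M s (compile K s P)" "depth P < K" "0 < B" "\<And>j. 0 < j \<Longrightarrow> j \<le> depth P \<Longrightarrow> pos j = 0"
    and "eval c B P (ys, h) = (ys', h')"
  shows "steps_to M (poly (time P) B) (conf K s (c, h) (loop_tape B) pos (output_tape ys))
     (conf K (s + states P) (c, h') (loop_tape B) pos (output_tape ys'))"
  using assms
proof (induction P arbitrary: s pos ys h ys' h')
  case Skip
  then show ?case by (simp add: steps_to_refl)
next
  case (Out f)
  have "step M (conf K s (c, h) (loop_tape B) pos (output_tape ys)) =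
     conf K (Suc s) (c, h) (loop_tape B) pos (output_tape (ys @ [f (c h)]))"
    using Out.prems write_output
    by (intro step_conf_eq[where A = "\<lambda>gs j. if j = K then (bit_symbol (f (gs ! 0)), MoveRight) else (gs ! j, Stay)"])
      (auto simp: loaded_Cons read_conf)
  then show ?case using Out.prems by (auto intro: steps_to_step[unfolded One_nat_def])
next
  case Advance
  have "step M (conf K s (c, h) (loop_tape B) pos (output_tape ys)) =
     conf K (Suc s) (c, Suc h) (loop_tape B) pos (output_tape ys)"
    using Advance.prems act_stay
    by (intro step_conf_eq[where A = "\<lambda>gs j. (gs ! j, if j = 0 then MoveRight else Stay)"])
      (auto simp: loaded_Cons read_conf)
  then show ?case using Advance.prems by (auto intro: steps_to_step[unfolded One_nat_def])
next
  case (Seq P Q)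
  obtain zs g where P: "eval c B P (ys, h) = (zs, g)" by fastforce
  then have Q: "eval c B Q (zs, g) = (ys', h')" using Seq.prems by simp
  have "steps_to M (poly (time P) B) (conf K s (c, h) (loop_tape B) pos (output_tape ys))
     (conf K (s + states P) (c, g) (loop_tape B) pos (output_tape zs))"
    using Seq.prems by (intro Seq.IH(1) P) (auto simp: loaded_append)
  moreover have "steps_to M (poly (time Q) B) (conf K (s + states P) (c, g) (loop_tape B) pos (output_tape zs))
     (conf K (s + states P + states Q) (c, h') (loop_tape B) pos (output_tape ys'))"
    using Seq.prems by (intro Seq.IH(2) Q) (auto simp: loaded_append)
  ultimately show ?case using steps_to_trans by (fastforce simp: add.assoc)
next
  case (Loop P)
  define a where "a = Suc (depth P)"
  define e where "e = s + states P"
  define st where "st i = (eval c B P ^^ i) (ys, h)" for i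
  have K: "0 < a" "a < K" "0 < K" "pos a = 0" using Loop.prems by (auto simp: a_def)
  have load: "s < length M" "loaded M (Suc s) (compile K (Suc s) P)"
    "M ! s = transit K (\<lambda>gs. if gs ! a = 2 then e + 2 else Suc s) (\<lambda>gs j. (gs ! j, Stay))"
    "Suc e < length M" "M ! Suc e = transit K (\<lambda>_. s) (\<lambda>gs j. (gs ! j, if j = a then MoveRight else Stay))"
    "e + 2 < length M" "M ! (e + 2) = transit K (\<lambda>gs. if gs ! a = 1 then e + 3 else e + 2)
        (\<lambda>gs j. (gs ! j, if j = a \<and> gs ! j \<noteq> 1 then MoveLeft else Stay))"
    using Loop.prems(1) unfolding a_def e_def by (auto simp: loaded_Cons loaded_append)
  define X where "X q i = conf K q (c, snd (st i)) (loop_tape B) (pos(a := i)) (output_tape (fst (st i)))" for q i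
  have iterate: "steps_to M (poly (time P) B + 2) (X s i) (X s (Suc i))" if "i < B" for i
  proof -
    have "step M (X s i) = X (Suc s) i"
      unfolding X_def using load K that act_stay
      by (intro step_conf_eq[where nxt = "\<lambda>gs. if gs ! a = 2 then e + 2 else Suc s" and
            A = "\<lambda>gs j. (gs ! j, Stay)"]) (auto simp: read_conf loop_tape_def)
    then have "steps_to M 1 (X s i) (X (Suc s) i)" by (rule steps_to_step)
    moreover have "steps_to M (poly (time P) B) (X (Suc s) i)
       (conf K (Suc s + states P) (c, snd (st (Suc i))) (loop_tape B) (pos(a := i)) (output_tape (fst (st (Suc i)))))"
      unfolding X_def using Loop.prems load by (intro Loop.IH) (auto simp: st_def a_def)
    moreover have "step M (conf K (Suc s + states P) (c, snd (st (Suc i))) (loop_tape B) (pos(a := i)) (output_tape (fst (st (Suc i)))))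
       = X s (Suc i)"
      unfolding X_def using load K act_stay
      by (intro step_conf_eq[where A = "\<lambda>gs j. (gs ! j, if j = a then MoveRight else Stay)"]) (auto simp: read_conf e_def)
    then have "steps_to M 1 (conf K (Suc s + states P) (c, snd (st (Suc i))) (loop_tape B) (pos(a := i)) (output_tape (fst (st (Suc i)))))
       (X s (Suc i))" by (rule steps_to_step)
    ultimately show ?thesis
      using steps_to_trans by (metis (no_types, lifting) add.commute add_2_eq_Suc' plus_1_eq_Suc add_Suc)
  qed
  have "steps_to M (B * (poly (time P) B + 2)) (X s 0) (X s B)"
    using iterate by (rule steps_to_iterate)
  moreover have "step M (X s B) = X (e + 2) B"
    unfolding X_def using load K Loop.prems(3) act_stay
    by (intro step_conf_eq[where nxt = "\<lambda>gs. if gs ! a = 2 then e + 2 else Suc s" and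
          A = "\<lambda>gs j. (gs ! j, Stay)"]) (auto simp: read_conf loop_tape_def)
  then have "steps_to M 1 (X s B) (X (e + 2) B)" by (rule steps_to_step)
  moreover
  define Y where "Y q i = conf K q (c, snd (st B)) (loop_tape B) (pos(a := B - i)) (output_tape (fst (st B)))" for q i
  have "step M (Y (e + 2) i) = Y (e + 2) (Suc i)" if "i < B" for i
    unfolding Y_def using load K that act_stay
    by (intro step_conf_eq[where nxt = "\<lambda>gs. if gs ! a = 1 then e + 3 else e + 2" and
          A = "\<lambda>gs j. (gs ! j, if j = a \<and> gs ! j \<noteq> 1 then MoveLeft else Stay)"])
      (auto simp: read_conf loop_tape_def)
  then have "steps_to M (B * 1) (Y (e + 2) 0) (Y (e + 2) B)"
    by (intro steps_to_iterate steps_to_step)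
  then have "steps_to M B (X (e + 2) B) (Y (e + 2) B)" by (simp add: X_def Y_def)
  moreover have "step M (Y (e + 2) B) = Y (e + 3) B"
    unfolding Y_def using load K act_stay
    by (intro step_conf_eq[where nxt = "\<lambda>gs. if gs ! a = 1 then e + 3 else e + 2" and
          A = "\<lambda>gs j. (gs ! j, if j = a \<and> gs ! j \<noteq> 1 then MoveLeft else Stay)"])
      (auto simp: read_conf loop_tape_def)
  then have "steps_to M 1 (Y (e + 2) B) (Y (e + 3) B)" by (rule steps_to_step)
  ultimately have "steps_to M (B * (poly (time P) B + 2) + 1 + B + 1) (X s 0) (Y (e + 3) B)"
    by (meson steps_to_trans)
  moreover have "pos(a := 0) = pos" using K by auto
  moreover have "st 0 = (ys, h)" "st B = (ys', h')" using Loop.prems(5) by (simp_all add: st_def)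
  ultimately show ?case by (simp add: X_def Y_def e_def algebra_simps)
qed

section \<open>Setting up the loop tapes\<close>

definition rewound :: "nat \<Rightarrow> nat list \<Rightarrow> bool" where
  "rewound K gs \<longleftrightarrow> (\<forall>j<K. gs ! j = 1)"

text \<open>The loop heads accompany the input head to the first blank and go one cell further, so
  the end mark is written in cell \<open>length x + 2\<close>; the bound is thus at least 2, and its
  powers dominate all polynomials. The heads return until all tapes but the output show 1, and the
  last step puts the output head on cell 1.\<close>

definition prelude :: "nat \<Rightarrow> machine" where
  "prelude K =
    [transit K (\<lambda>gs. if gs ! 0 = 0 then 1 else 0)
       (\<lambda>gs j. (gs ! j, if j = K \<or> j = 0 \<and> gs ! 0 = 0 then Stay else MoveRight)),
     transit K (\<lambda>_. 2) (\<lambda>gs j. if 0 < j \<and> j < K then (2, Stay) else (gs ! j, Stay)),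
     transit K (\<lambda>gs. if rewound K gs then 3 else 2)
       (\<lambda>gs j. (gs ! j, if j = K then if rewound K gs then MoveRight else Stay
          else if rewound K gs then Stay else MoveLeft))]"

lemma init_conf: "0 < K \<Longrightarrow> init (Suc K) x = conf K 0 (tape_of x) (fst (tape_of [])) (\<lambda>_. 0) (tape_of [])"
  unfolding conf_def init_def
  by (auto intro!: nth_equalityI simp: nth_Cons' tape_of_def simp del: upt_Suc)

lemma tape_of_0: "fst (tape_of x) i = 0 \<longleftrightarrow> length x < i"
  and tape_of_1: "fst (tape_of x) i = 1 \<longleftrightarrow> i = 0"
proof -
  have "bit_symbol b \<noteq> 0" "bit_symbol b \<noteq> 1" for b by (cases b; simp)+
  then show "fst (tape_of x) i = 0 \<longleftrightarrow> length x < i" "fst (tape_of x) i = 1 \<longleftrightarrow> i = 0"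
    by (auto simp: tape_of_def)
qed

lemma prelude_correct:
  assumes "loaded M 0 (prelude K)" "2 \<le> K"
  shows "steps_to M (2 * length x + 6) (init (Suc K) x)
    (conf K 3 (fst (tape_of x), 0) (loop_tape (length x + 2)) (\<lambda>_. 0) (output_tape []))"
proof -
  let ?c = "fst (tape_of x)" and ?B = "length x + 2" and ?E = "fst (tape_of [])"
  have load: "0 < length M" "1 < length M" "2 < length M"
    "M ! 0 = prelude K ! 0" "M ! 1 = prelude K ! 1" "M ! 2 = prelude K ! 2"
    using assms(1) by (auto simp: loaded_Cons prelude_def numeral_2_eq_2)
  have K: "0 < K" "1 < K" using assms(2) by auto
  define X where "X q h p = conf K q (?c, h) ?E (\<lambda>_. p) (tape_of [])" for q h p
  have "step M (X 0 i i) = X 0 (Suc i) (Suc i)" if "i < Suc (length x)" for i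
    unfolding X_def using load K that act_stay
    by (intro step_conf_eq[where nxt = "\<lambda>gs. if gs ! 0 = 0 then 1 else 0" and
          A = "\<lambda>gs j. (gs ! j, if j = K \<or> j = 0 \<and> gs ! 0 = 0 then Stay else MoveRight)"])
      (auto simp: read_conf prelude_def tape_of_0)
  then have "steps_to M (Suc (length x) * 1) (X 0 0 0) (X 0 (Suc (length x)) (Suc (length x)))"
    by (intro steps_to_iterate[where x = "\<lambda>i. X 0 i i"] steps_to_step)
  moreover have "step M (X 0 (Suc (length x)) (Suc (length x))) = X 1 (Suc (length x)) ?B"
    unfolding X_def using load K act_stay
    by (intro step_conf_eq[where nxt = "\<lambda>gs. if gs ! 0 = 0 then 1 else 0" and
          A = "\<lambda>gs j. (gs ! j, if j = K \<or> j = 0 \<and> gs ! 0 = 0 then Stay else MoveRight)"])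
      (auto simp: read_conf prelude_def tape_of_0)
  then have "steps_to M 1 (X 0 (Suc (length x)) (Suc (length x))) (X 1 (Suc (length x)) ?B)"
    by (rule steps_to_step)
  moreover
  define Y where "Y q i = conf K q (?c, Suc (length x) - i) (loop_tape ?B) (\<lambda>_. ?B - i) (tape_of [])" for q i
  have "?E(?B := 2) = loop_tape ?B" by (auto simp: loop_tape_def tape_of_def)
  then have "step M (X 1 (Suc (length x)) ?B) = Y 2 0"
    unfolding X_def Y_def using load K act_stay
    by (intro step_conf_eq[where A = "\<lambda>gs j. if 0 < j \<and> j < K then (2, Stay) else (gs ! j, Stay)"])
      (auto simp: read_conf prelude_def)
  then have "steps_to M 1 (X 1 (Suc (length x)) ?B) (Y 2 0)" by (rule steps_to_step)
  moreover
  let ?A = "\<lambda>gs j. (gs ! j, if j = K then if rewound K gs then MoveRight else Stay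
          else if rewound K gs then Stay else MoveLeft)"
  have "step M (Y 2 i) = Y 2 (Suc i)" if i: "i < ?B" for i
  proof -
    let ?gs = "map read (snd (Y 2 i))"
    \<comment> \<open>Tape 1 is a loop tape; its head has farther to go than that of the input,
      which waits at cell 0.\<close>
    have "?gs ! 1 \<noteq> 1" unfolding Y_def using K i by (simp add: read_conf loop_tape_def)
    then have "\<not> rewound K ?gs" using K unfolding rewound_def by blast
    then show ?thesis
      unfolding Y_def using load K act_stay
      by (intro step_conf_eq[where nxt = "\<lambda>gs. if rewound K gs then 3 else 2" and A = ?A]) (auto simp: read_conf prelude_def)
  qed
  then have "steps_to M (?B * 1) (Y 2 0) (Y 2 ?B)"
    by (intro steps_to_iterate steps_to_step)
  moreover have "step M (Y 2 ?B) = conf K 3 (?c, 0) (loop_tape ?B) (\<lambda>_. 0) (output_tape [])"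
  proof -
    let ?gs = "map read (snd (Y 2 ?B))"
    have "rewound K ?gs"
      unfolding Y_def rewound_def using K by (auto simp: read_conf loop_tape_def tape_of_1 tape_of_def)
    then show ?thesis
      unfolding Y_def using load K act_stay
      by (intro step_conf_eq[where nxt = "\<lambda>gs. if rewound K gs then 3 else 2" and A = ?A]) (auto simp: read_conf prelude_def output_tape_def tape_of_def)
  qed
  then have "steps_to M 1 (Y 2 ?B) (conf K 3 (?c, 0) (loop_tape ?B) (\<lambda>_. 0) (output_tape []))"
    by (rule steps_to_step)
  ultimately have "steps_to M (Suc (length x) * 1 + 1 + 1 + ?B * 1 + 1) (X 0 0 0)
      (conf K 3 (?c, 0) (loop_tape ?B) (\<lambda>_. 0) (output_tape []))"
    by (meson steps_to_trans)
  moreover have "(?c, 0) = tape_of x" by (simp add: tape_of_def)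
  ultimately show ?thesis
    using K steps_to_mono[where n = "2 * length x + 6"] by (simp add: X_def init_conf)
qed

definition well_formed :: "nat \<Rightarrow> nat \<Rightarrow> (nat list \<Rightarrow> nat \<times> (nat \<times> move) list) \<Rightarrow> bool" where
  "well_formed K n \<delta> \<longleftrightarrow> (\<forall>gs. length gs = Suc K \<and> set gs \<subseteq> {..<4} \<longrightarrow>
     fst (\<delta> gs) \<le> n \<and> length (snd (\<delta> gs)) = Suc K \<and> fst ` set (snd (\<delta> gs)) \<subseteq> {..<4})"

lemma well_formed_transit:
  assumes "\<And>gs. nxt gs \<le> n" "\<And>gs j. length gs = Suc K \<Longrightarrow> set gs \<subseteq> {..<4} \<Longrightarrow> j \<le> K \<Longrightarrow> gs ! j < 4 \<Longrightarrow> fst (A gs j) < 4"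
  shows "well_formed K n (transit K nxt A)"
  unfolding well_formed_def transit_def
proof (intro allI impI conjI)
  fix gs :: "nat list" assume gs: "length gs = Suc K \<and> set gs \<subseteq> {..<4}"
  have "fst (A gs j) < 4" if "j \<le> K" for j
  proof -
    have "gs ! j \<in> set gs" using gs that by (intro nth_mem) simp
    then have "gs ! j < 4" using gs by blast
    then show ?thesis using gs that by (intro assms(2)) auto
  qed
  then show "fst ` set (snd (nxt gs, map (A gs) [0..<Suc K])) \<subseteq> {..<4}"
    by (auto simp: less_Suc_eq_le simp del: upt_Suc)
qed (use assms(1) in auto)

lemma bit_symbol_less: "bit_symbol b < 4"
  by (cases b) auto

lemma well_formed_prelude: "\<delta> \<in> set (prelude K) \<Longrightarrow> 3 \<le> n \<Longrightarrow> well_formed K n \<delta>"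
  unfolding prelude_def by (auto intro!: well_formed_transit)

lemma well_formed_compile:
  "\<delta> \<in> set (compile K s P) \<Longrightarrow> s + states P \<le> n \<Longrightarrow> well_formed K n \<delta>"
proof (induction P arbitrary: s)
  case (Seq P Q)
  then show ?case using Seq.IH(1)[of s] Seq.IH(2)[of "s + states P"] by auto
next
  case (Loop P)
  then show ?case using Loop.IH[of "Suc s"] by (auto intro!: well_formed_transit)
qed (auto intro!: well_formed_transit simp: bit_symbol_less)

theorem prog_polytime:
  "polytime_computable (\<lambda>x. fst (eval (fst (tape_of x)) (length x + 2) P ([], 0)))"
proof -
  \<comment> \<open>One loop tape beyond the nesting depth, so that the prelude has one to steer by
    even if the program contains no loop.\<close>
  define K where "K = depth P + 2"
  define M where "M = prelude K @ compile K 3 P"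
  define p where "p = [:6, 2:] + pcompose (time P) [:2, 1:]"
  have len: "length (prelude K) = 3" for K by (simp add: prelude_def)
  have l: "loaded M 0 (prelude K)" "loaded M 3 (compile K 3 P)"
    using loaded_append[of M 0 "prelude K" "compile K 3 P"] len by (auto simp: loaded_def M_def)
  have "\<forall>\<delta> \<in> set M. well_formed K (length M) \<delta>"
    using well_formed_prelude[of _ K "length M"] well_formed_compile[of _ K 3 P "length M"] len
    by (auto simp: M_def)
  then have "turing_machine (Suc K) 4 M"
    unfolding turing_machine_def well_formed_def by simp
  moreover have "\<exists>t \<le> poly p (length x). halts_with_output M (run M (Suc K) x t)
      (fst (eval (fst (tape_of x)) (length x + 2) P ([], 0)))" for x
  proof -
    obtain ys h where ys: "eval (fst (tape_of x)) (length x + 2) P ([], 0) = (ys, h)" by fastforce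
    have "steps_to M (2 * length x + 6 + poly (time P) (length x + 2)) (init (Suc K) x)
      (conf K (3 + states P) (fst (tape_of x), h) (loop_tape (length x + 2)) (\<lambda>_. 0) (output_tape ys))"
      using l ys by (intro steps_to_trans[OF prelude_correct compile_correct]) (auto simp: K_def)
    then obtain t where t: "t \<le> poly p (length x)" "run M (Suc K) x t =
      conf K (3 + states P) (fst (tape_of x), h) (loop_tape (length x + 2)) (\<lambda>_. 0) (output_tape ys)"
      unfolding steps_to_def run_def by (auto simp: p_def poly_pcompose algebra_simps)
    have "halts_with_output M (run M (Suc K) x t) ys"
      unfolding t(2) halts_with_output_def
      by (simp add: conf_def M_def len output_tape_def tape_of_def K_def)
    then show ?thesis using t(1) ys by auto
  qed
  ultimately show ?thesis unfolding polytime_computable_def by blast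
qed

section \<open>Printing formulas\<close>

text \<open>In prefix notation, a formula with a hole at its right end is a prefix of the string. The
  number of iterations of a loop and the input symbol in view are the parameters of what is printed.\<close>

definition prints :: "prog \<Rightarrow> (nat \<Rightarrow> nat) \<Rightarrow> nat \<Rightarrow> nat \<Rightarrow> nat \<Rightarrow> (fm \<Rightarrow> fm) \<Rightarrow> bool" where
  "prints P c B h h' F \<longleftrightarrow> (\<exists>w. (\<forall>ys. eval c B P (ys, h) = (ys @ w, h')) \<and> (\<forall>\<phi>. enc_fm (F \<phi>) = w @ enc_fm \<phi>))"

definition printable :: "(nat \<Rightarrow> nat \<Rightarrow> fm) \<Rightarrow> bool" where
  "printable \<phi> \<longleftrightarrow> (\<exists>P. \<forall>B c h ys. eval c B P (ys, h) = (ys @ enc_fm (\<phi> B (c h)), h))"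

definition printable_ctx :: "(nat \<Rightarrow> nat \<Rightarrow> fm \<Rightarrow> fm) \<Rightarrow> bool" where
  "printable_ctx F \<longleftrightarrow> (\<exists>P. \<forall>B c h. prints P c B h h (F B (c h)))"

lemma prints_Seq: "prints P c B h h1 F \<Longrightarrow> prints Q c B h1 h2 F' \<Longrightarrow> prints (Seq P Q) c B h h2 (F \<circ> F')"
  unfolding prints_def by fastforce

lemma prints_Skip: "prints Skip c B h h id"
  unfolding prints_def by simp

lemma prints_Advance: "prints Advance c B h (Suc h) id"
  unfolding prints_def by simp

primrec loops :: "nat \<Rightarrow> prog \<Rightarrow> prog" where
  "loops 0 P = P"
| "loops (Suc d) P = Loop (loops d P)"

lemma eval_loops: "eval c B (loops d P) = eval c B P ^^ (B ^ d)"
  by (induction d) (auto simp: funpow_mult mult.commute)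

text \<open>\<open>F 0\<close> is the outermost context, because the first iteration prints the
  leftmost word.\<close>

primrec compose :: "(nat \<Rightarrow> fm \<Rightarrow> fm) \<Rightarrow> nat \<Rightarrow> fm \<Rightarrow> fm" where
  "compose F 0 \<phi> = \<phi>"
| "compose F (Suc n) \<phi> = compose F n (F n \<phi>)"

lemma compose_const: "compose (\<lambda>_. F) n = F ^^ n"
proof
  show "compose (\<lambda>_. F) n \<phi> = (F ^^ n) \<phi>" for \<phi>
    by (induction n arbitrary: \<phi>) (auto simp: funpow_swap1)
qed

lemma foldr_compose: "foldr f (map g [0..<n]) \<phi> = compose (\<lambda>i. f (g i)) n \<phi>"
  by (induction n arbitrary: \<phi>) auto

text \<open>\<open>s\<close> is the advance of the input head in one iteration: 0 when a fixed word
  is repeated, 1 when the printed row follows the input.\<close>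

lemma prints_loops:
  assumes "\<And>i. i < B ^ d \<Longrightarrow> prints P c B (h + i * s) (h + Suc i * s) (F i)"
  shows "prints (loops d P) c B h (h + B ^ d * s) (compose F (B ^ d))"
proof -
  have "\<exists>w. (\<forall>ys. (eval c B P ^^ n) (ys, h) = (ys @ w, h + n * s)) \<and>
      (\<forall>\<phi>. enc_fm (compose F n \<phi>) = w @ enc_fm \<phi>)" if "n \<le> B ^ d" for n
    using that
  proof (induction n)
    case (Suc n)
    then obtain w where w: "\<forall>ys. (eval c B P ^^ n) (ys, h) = (ys @ w, h + n * s)"
      "\<forall>\<phi>. enc_fm (compose F n \<phi>) = w @ enc_fm \<phi>" by auto
    obtain u where u: "\<forall>ys. eval c B P (ys, h + n * s) = (ys @ u, h + Suc n * s)"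
      "\<forall>\<phi>. enc_fm (F n \<phi>) = u @ enc_fm \<phi>"
      using assms[of n] Suc.prems unfolding prints_def by auto
    then show ?case using w u by (intro exI[of _ "w @ u"]) simp
  qed simp
  from this[OF order_refl] show ?thesis unfolding prints_def eval_loops .
qed

lemma printable_ctx_id: "printable_ctx (\<lambda>_ _. id)"
  unfolding printable_ctx_def using prints_Skip by blast

lemma printable_ctx_comp:
  assumes "printable_ctx F" "printable_ctx F'"
  shows "printable_ctx (\<lambda>B g. F B g \<circ> F' B g)"
  using assms prints_Seq unfolding printable_ctx_def by metis

lemma printable_ctx_loops:
  assumes "printable_ctx F"
  shows "printable_ctx (\<lambda>B g. F B g ^^ (B ^ d))"
proof -
  obtain P where P: "\<And>B c h. prints P c B h h (F B (c h))"
    using assms unfolding printable_ctx_def by blast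
  have "prints (loops d P) c B h h (F B (c h) ^^ (B ^ d))" for c B h
    using prints_loops[of B d P c h 0 "\<lambda>_. F B (c h)"] P by (simp add: compose_const)
  then show ?thesis unfolding printable_ctx_def by blast
qed

lemma printable_ctx_power:
  assumes "printable_ctx F"
  shows "printable_ctx (\<lambda>B g. F B g ^^ n)"
proof (induction n)
  case 0
  then show ?case using printable_ctx_id by (simp add: id_def)
next
  case (Suc n)
  then show ?case unfolding funpow.simps by (rule printable_ctx_comp[OF assms])
qed

lemma printable_ctx_loops_add:
  assumes "printable_ctx F"
  shows "printable_ctx (\<lambda>B g. F B g ^^ (B ^ d + n))"
  using printable_ctx_comp[OF printable_ctx_loops[OF assms] printable_ctx_power[OF assms]]
  by (simp add: funpow_add)

lemma printable_apply:
  assumes "printable_ctx F" "printable \<phi>"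
  shows "printable (\<lambda>B g. F B g (\<phi> B g))"
proof -
  obtain P where P: "\<And>B c h. prints P c B h h (F B (c h))"
    using assms unfolding printable_ctx_def by blast
  obtain Q where Q: "\<And>B c h ys. eval c B Q (ys, h) = (ys @ enc_fm (\<phi> B (c h)), h)"
    using assms unfolding printable_def by blast
  have "eval c B (Seq P Q) (ys, h) = (ys @ enc_fm (F B (c h) (\<phi> B (c h))), h)" for c B h ys
    using P[of c B h] Q unfolding prints_def by auto
  then show ?thesis unfolding printable_def by blast
qed

lemma print_bits: "\<exists>P. \<forall>B c h ys. eval c B P (ys, h) = (ys @ map (\<lambda>f. f (c h)) fs, h)"
proof (induction fs)
  case Nil
  have "\<forall>B c h ys. eval c B Skip (ys, h) = (ys @ map (\<lambda>f. f (c h)) [], h)" by simp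
  then show ?case by blast
next
  case (Cons f fs)
  then obtain P where "\<forall>B c h ys. eval c B P (ys, h) = (ys @ map (\<lambda>f. f (c h)) fs, h)" by blast
  then have "\<forall>B c h ys. eval c B (Seq (Out f) P) (ys, h) = (ys @ map (\<lambda>f. f (c h)) (f # fs), h)" by simp
  then show ?case by blast
qed

lemma print_word: "\<exists>P. \<forall>B c h ys. eval c B P (ys, h) = (ys @ w, h)"
  using print_bits[of "map (\<lambda>b _. b) w"] by (simp add: comp_def)

lemma printable_const: "printable (\<lambda>_ _. \<phi>)"
  unfolding printable_def by (rule print_word)

lemma printable_ctx_const:
  assumes "\<And>\<phi>. enc_fm (F \<phi>) = w @ enc_fm \<phi>"
  shows "printable_ctx (\<lambda>_ _. F)"
  using print_word[of w] assms unfolding printable_ctx_def prints_def by blast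

lemma printable_ctx_Box: "printable_ctx (\<lambda>_ _. Box)"
  by (rule printable_ctx_const) (rule enc_fm.simps)

lemma printable_ctx_Dia: "printable_ctx (\<lambda>_ _. Dia)"
  by (rule printable_ctx_const) (rule enc_fm.simps)

lemma printable_ctx_And:
  assumes "printable \<phi>"
  shows "printable_ctx (\<lambda>B g. And (\<phi> B g))"
proof -
  obtain P where P: "\<forall>B c h ys. eval c B P (ys, h) = (ys @ [False, True, True], h)"
    using print_word by blast
  obtain Q where Q: "\<forall>B c h ys. eval c B Q (ys, h) = (ys @ enc_fm (\<phi> B (c h)), h)"
    using assms unfolding printable_def by blast
  have "prints (Seq P Q) c B h h (And (\<phi> B (c h)))" for c B h
    unfolding prints_def using P Q by (intro exI[of _ "[False, True, True] @ enc_fm (\<phi> B (c h))"]) simp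
  then show ?thesis unfolding printable_ctx_def by blast
qed

lemma printable_And: "printable \<phi> \<Longrightarrow> printable \<psi> \<Longrightarrow> printable (\<lambda>B g. And (\<phi> B g) (\<psi> B g))"
  using printable_apply[OF printable_ctx_And] by blast

lemma printable_Dia: "printable \<phi> \<Longrightarrow> printable (\<lambda>B g. Dia (\<phi> B g))"
  by (rule printable_apply[OF printable_ctx_Dia])

lemma printable_Boxes: "printable \<phi> \<Longrightarrow> printable (\<lambda>B g. (Box ^^ n) (\<phi> B g))"
  by (rule printable_apply[OF printable_ctx_power[OF printable_ctx_Box]])

text \<open>The variables 2 and 3 have codes of equal length, so that the machine need not branch.\<close>

lemma printable_if: "printable (\<lambda>B g. if al g then Pos 2 else Neg 3)"
proof -
  let ?fs = "map (\<lambda>i g. enc_fm (if al g then Pos 2 else Neg 3) ! i) [0..<8]"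
  have "enc_nat 2 = [True, False, True, True, False]" "enc_nat 3 = [True, True, True, True, False]"
    by (simp_all add: enc_nat.simps)
  then have len: "length (enc_fm (if b then Pos 2 else Neg 3)) = 8" for b
    by simp
  have "map (\<lambda>f. f g) ?fs = enc_fm (if al g then Pos 2 else Neg 3)" for g
    using len[of "al g"] by (intro nth_equalityI) auto
  then show ?thesis using print_bits[of ?fs] unfolding printable_def by simp
qed

section \<open>Printing the reduction\<close>

lemma printable_ctx_info: "printable_ctx (\<lambda>_ _. info_ctx S)"
proof -
  have "printable_ctx (\<lambda>_ _. foldr (\<lambda>i. And (Dia (mark i))) S)"
  proof (induction S)
    case Nil
    then show ?case using printable_ctx_id by (simp add: id_def)
  next
    case (Cons i S)
    then show ?case
      unfolding foldr.simps by (rule printable_ctx_comp[OF printable_ctx_And[OF printable_const]])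
  qed
  moreover have e: "info_ctx S = foldr (\<lambda>i. And (Dia (mark i))) S \<circ> Box"
    by (simp add: info_ctx_def fun_eq_iff)
  ultimately show ?thesis unfolding e by (intro printable_ctx_comp printable_ctx_Box)
qed

lemma printable_ctx_infos: "printable_ctx (\<lambda>_ _. foldr info_ctx I)"
proof (induction I)
  case Nil
  then show ?case using printable_ctx_id by (simp add: id_def)
next
  case (Cons S I)
  then show ?case unfolding foldr.simps by (rule printable_ctx_comp[OF printable_ctx_info])
qed

lemma foldr_concat_replicate: "foldr f (concat (replicate n xs)) = foldr f xs ^^ n"
  by (induction n) (auto simp: comp_def fun_eq_iff)

lemma printable_info:
  "printable (\<lambda>B g. info (I @ concat (replicate (B ^ d + n) K) @ L))"
proof -
  have "printable (\<lambda>B g. foldr info_ctx I ((foldr info_ctx K ^^ (B ^ d + n)) (foldr info_ctx L (Pos 2))))"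
    by (rule printable_apply[OF printable_ctx_infos
        printable_apply[OF printable_ctx_loops_add[OF printable_ctx_infos] printable_const]])
  then show ?thesis by (simp add: info_def foldr_concat_replicate)
qed

lemma printable_ctx_check: "printable_ctx (\<lambda>_ _. check)"
proof -
  have e: "check = And AtMost2 \<circ> Dia" by (simp add: check_def fun_eq_iff)
  show ?thesis
    unfolding e by (intro printable_ctx_comp printable_ctx_And printable_const printable_ctx_Dia)
qed

lemma printable_comb:
  assumes "\<And>a. a \<in> set as \<Longrightarrow> printable (\<lambda>B g. f B g a)"
  shows "printable (\<lambda>B g. comb (f B g) as)"
  using assms
proof (induction as)
  case (Cons a as)
  have "printable (\<lambda>B g. And AtMost2 (And (Dia (And (Pos 0) ((Box ^^ length as) (f B g a))))
     (Dia (And (Neg 0) (comb (f B g) as)))))"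
    using Cons by (intro printable_And printable_Dia printable_Boxes printable_const) auto
  then show ?case by simp
qed (simp add: printable_const)

lemma stretch_append: "stretch r (I @ K) = stretch r I @ stretch r K"
  by (simp add: stretch_def)

lemma stretch_replicate: "stretch r (replicate n S) = concat (replicate n (S @ replicate r []))"
  by (simp add: stretch_def)

section \<open>Chunks and the first row as printed contexts\<close>

definition first_row :: "(nat \<Rightarrow> nat \<Rightarrow> nat \<Rightarrow> bool) \<Rightarrow> nat \<Rightarrow> (nat \<Rightarrow> nat) \<Rightarrow> (nat \<Rightarrow> bool) list" where
  "first_row al w c = map (\<lambda>i. al (flag w i) (c i)) [0..<Suc w]"

context
  fixes r :: nat and dec :: "nat \<Rightarrow> 'c \<times> 'c \<times> 'c" and S :: "'c set" and h v :: "'c \<Rightarrow> 'c \<Rightarrow> bool"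
  assumes dec: "bij_betw dec {..<r} (S \<times> S \<times> S)" and r: "0 < r"
begin

interpretation T: savitch w r dec S h v for w
  by standard (rule dec r)+

lemma printable_cell_info: "printable (\<lambda>B g. info (stretch r (T.cell_info (B ^ d + n) a)))"
proof -
  have e: "stretch r (T.cell_info w a) = stretch r [T.right_marks a, T.left_marks a] @
      concat (replicate w (T.none @ replicate r [])) @ stretch r [T.upper_marks a]" for w
    unfolding T.cell_info_def stretch_replicate[symmetric] stretch_append[symmetric] by simp
  show ?thesis unfolding e by (rule printable_info)
qed

lemma printable_bit_info: "printable (\<lambda>B g. info (stretch r (T.bit_info (B ^ d + n) b)))"
proof -
  have e: "stretch r (T.bit_info w b) = stretch r [T.none] @
      concat (replicate (w + 1) (T.bit_marks b @ replicate r [])) @ []" for w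
    unfolding T.bit_info_def stretch_replicate[symmetric] stretch_append[symmetric]
    by (simp add: stretch_def)
  show ?thesis unfolding e add.assoc by (rule printable_info)
qed

lemma printable_exists_chunk: "printable_ctx (\<lambda>B g. T.exists_chunk (B ^ d + n) (al g))"
proof -
  have e: "T.exists_chunk w f = And (comb (leaf f (\<lambda>a. stretch r (T.cell_info w a))) [0..<r])
      \<circ> (Dia ^^ r \<circ> (And (Pos 3) \<circ> check ^^ length (conflicts dec h r)))" for w f
    by (simp add: fun_eq_iff T.exists_chunk_def)
  show ?thesis
    unfolding e leaf_def
    by (intro printable_ctx_comp printable_ctx_And printable_comb printable_And printable_if printable_cell_info
        printable_ctx_power printable_ctx_Dia printable_ctx_check printable_const)
qed

lemma printable_forall_chunk: "printable_ctx (\<lambda>B g. T.forall_chunk (B ^ d + n))"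
proof -
  have e: "T.forall_chunk w =
     And (Dia (And (Pos 0) ((Box ^^ (r - 1)) (And (Pos 2) (info (stretch r (T.bit_info w True)))))))
     \<circ> (And (Dia (And (Neg 0) ((Box ^^ (r - 1)) (And (Pos 2) (info (stretch r (T.bit_info w False)))))))
     \<circ> (Box \<circ> (Dia ^^ (r - 1) \<circ> check ^^ length (conflicts dec h r))))" for w
    by (simp add: fun_eq_iff T.forall_chunk_def)
  show ?thesis
    unfolding e
    by (intro printable_ctx_comp printable_ctx_And printable_And printable_Dia printable_Boxes printable_bit_info
        printable_ctx_power printable_ctx_Box printable_ctx_Dia printable_ctx_check printable_const)
qed

lemma formula_append:
  "T.formula w (map Exists als @ ps) = foldr (T.exists_chunk w) als (T.formula w ps)"
  by (induction als) auto

lemma formula_rounds: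
  "T.formula w (T.rounds w m als fin) = foldr (T.exists_chunk w) als
    (((T.forall_chunk w \<circ> T.exists_chunk w (\<lambda>_. True) ^^ Suc w) ^^ m)
    (T.forall_chunk w ((T.exists_chunk w fin ^^ Suc w) (Pos 2))))"
proof -
  have rep: "foldr f (replicate n x) y = (f x ^^ n) y" for f :: "'x \<Rightarrow> 'y \<Rightarrow> 'y" and n x y
    by (induction n) auto
  have "T.formula w (concat (replicate m (Forall # map Exists (replicate (Suc w) (\<lambda>_. True)))) @ ps) =
    ((T.forall_chunk w \<circ> T.exists_chunk w (\<lambda>_. True) ^^ Suc w) ^^ m) (T.formula w ps)" for ps
  proof (induction m)
    case (Suc m)
    show ?case
      by (simp only: replicate_Suc[of m] concat.simps append_assoc append_Cons T.formula.simps formula_append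
          rep Suc funpow.simps(2)[of m] comp_apply)
  qed simp
  then show ?thesis
    using formula_append[of w "replicate (Suc w) fin" "[]"]
    by (simp add: T.rounds_def formula_append rep del: replicate_Suc map_replicate funpow.simps(2))
qed

text \<open>Along the row the flags are 0, 1, then 2 for \<open>B ^ d\<close> cells, then 3; this is
  the origin of the width \<open>B ^ d + 2\<close>. One program for each flag suffices. The input
  head advances with the cells and runs on into the blanks behind the input.\<close>

lemma print_first_row:
  "\<exists>P. \<forall>B c. \<exists>h. prints P c B 0 h (foldr (T.exists_chunk (B ^ d + 2)) (first_row al (B ^ d + 2) c))"
proof -
  have "\<exists>P. \<forall>B c h. prints P c B h h (T.exists_chunk (B ^ d + 2) (al f (c h)))" for f
    using printable_exists_chunk[of d 2 "al f"] unfolding printable_ctx_def .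
  then obtain P where P: "\<And>f B c h. prints (P f) c B h h (T.exists_chunk (B ^ d + 2) (al f (c h)))"
    by metis
  define Q where "Q f = Seq (P f) Advance" for f
  have Q: "prints (Q f) c B h (Suc h) (T.exists_chunk (B ^ d + 2) (al f (c h)))" for f B c h
    using prints_Seq[OF P prints_Advance] by (simp add: Q_def)
  have "prints (Seq (Q 0) (Seq (Q 1) (Seq (loops d (Q 2)) (P 3)))) c B 0 (B ^ d + 2)
      (foldr (T.exists_chunk (B ^ d + 2)) (first_row al (B ^ d + 2) c))" for B c
  proof -
    let ?w = "B ^ d + 2"
    let ?X = "\<lambda>f i. T.exists_chunk ?w (al f (c i))"
    have "prints (loops d (Q 2)) c B 2 (2 + B ^ d * 1) (compose (\<lambda>i. ?X 2 (2 + i)) (B ^ d))"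
      by (intro prints_loops) (use Q[of 2 c B] in simp)
    then have "prints (Seq (Q 0) (Seq (Q 1) (Seq (loops d (Q 2)) (P 3)))) c B 0 (B ^ d + 2)
       (?X 0 0 \<circ> (?X 1 1 \<circ> (compose (\<lambda>i. ?X 2 (2 + i)) (B ^ d) \<circ> ?X 3 ?w)))"
      using Q[of 0 c B 0] Q[of 1 c B 1] P[of 3 c B ?w]
      by (intro prints_Seq) (simp_all add: numeral_2_eq_2)
    moreover have "first_row al ?w c = [al 0 (c 0), al 1 (c 1)] @ map (\<lambda>i. al 2 (c (2 + i))) [0..<B ^ d] @ [al 3 (c ?w)]"
      by (rule nth_equalityI)
        (auto simp: first_row_def nth_append nth_Cons flag_def less_Suc_eq_le simp del: upt_Suc split: nat.splits)
    moreover have "foldr (T.exists_chunk ?w) (first_row al ?w c) =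
        ?X 0 0 \<circ> (?X 1 1 \<circ> (compose (\<lambda>i. ?X 2 (2 + i)) (B ^ d) \<circ> ?X 3 ?w))"
      unfolding calculation(2) foldr_append comp_def foldr_compose by simp
    ultimately show ?thesis by simp
  qed
  then show ?thesis by blast
qed

theorem polytime_rounds:
  "polytime_computable (\<lambda>x. enc_fm (T.formula ((length x + 2) ^ d + 2)
     (T.rounds ((length x + 2) ^ d + 2) ((length x + 2) ^ e)
       (first_row al ((length x + 2) ^ d + 2) (fst (tape_of x))) fin)))"
proof -
  obtain P where P: "\<And>B c. \<exists>h. prints P c B 0 h (foldr (T.exists_chunk (B ^ d + 2)) (first_row al (B ^ d + 2) c))"
    using print_first_row by blast
  have "printable (\<lambda>B g.
      ((T.forall_chunk (B ^ d + 2) \<circ> T.exists_chunk (B ^ d + 2) (\<lambda>_. True) ^^ (B ^ d + 3)) ^^ (B ^ e))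
      (T.forall_chunk (B ^ d + 2) ((T.exists_chunk (B ^ d + 2) fin ^^ (B ^ d + 3)) (Pos 2))))"
    by (rule printable_apply[OF printable_ctx_loops[OF printable_ctx_comp[OF printable_forall_chunk
            printable_ctx_loops_add[OF printable_exists_chunk[of _ _ "\<lambda>_ _. True"]]]]
          printable_apply[OF printable_forall_chunk
            printable_apply[OF printable_ctx_loops_add[OF printable_exists_chunk[of _ _ "\<lambda>_. fin"]] printable_const]]])
  then obtain Q where Q: "\<And>B c h ys. eval c B Q (ys, h) = (ys @ enc_fm (
      ((T.forall_chunk (B ^ d + 2) \<circ> T.exists_chunk (B ^ d + 2) (\<lambda>_. True) ^^ (B ^ d + 3)) ^^ (B ^ e))
      (T.forall_chunk (B ^ d + 2) ((T.exists_chunk (B ^ d + 2) fin ^^ (B ^ d + 3)) (Pos 2)))), h)"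
    unfolding printable_def by blast
  have suc: "Suc (B ^ d + 2) = B ^ d + 3" for B :: nat by simp
  have "fst (eval c B (Seq P Q) ([], 0)) = enc_fm (T.formula (B ^ d + 2)
     (T.rounds (B ^ d + 2) (B ^ e) (first_row al (B ^ d + 2) c) fin))" for B c
  proof -
    obtain h w where "\<forall>ys. eval c B P (ys, 0) = (ys @ w, h)"
      "\<forall>\<phi>. enc_fm (foldr (T.exists_chunk (B ^ d + 2)) (first_row al (B ^ d + 2) c) \<phi>) = w @ enc_fm \<phi>"
      using P[of c B] unfolding prints_def by blast
    moreover have "eval c B (Seq P Q) s = eval c B Q (eval c B P s)" for s by simp
    ultimately show ?thesis unfolding formula_rounds suc by (simp only: Q append_Nil fst_conv)
  qed
  then show ?thesis using prog_polytime[of "Seq P Q"] by simp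
qed

end

section \<open>The reduction\<close>

text \<open>As the base is at least 2, a larger exponent absorbs every coefficient.\<close>

lemma poly_le_power:
  fixes p :: "nat poly"
  shows "\<exists>d. \<forall>e\<ge>d. \<forall>n. poly p n \<le> (n + 2) ^ e"
proof (induction p)
  case 0
  then show ?case by simp
next
  case (pCons a p)
  then obtain d where d: "\<And>e n. d \<le> e \<Longrightarrow> poly p n \<le> (n + 2) ^ e" by blast
  have "poly (pCons a p) n \<le> (n + 2) ^ e" if e: "a + d + 2 \<le> e" for e n
  proof -
    have "a \<le> 2 ^ a" by (simp add: less_imp_le)
    also have "\<dots> \<le> (n + 2) ^ a" by (intro power_mono) auto
    also have "\<dots> \<le> (n + 2) ^ (e - 1)" using e by (intro power_increasing) auto
    finally have a: "a \<le> (n + 2) ^ (e - 1)" .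
    have "n * poly p n \<le> (n + 2) * (n + 2) ^ (e - 2)" using d[of "e - 2" n] e by (intro mult_mono) auto
    also have "\<dots> = (n + 2) ^ Suc (e - 2)" by simp
    also have "Suc (e - 2) = e - 1" using e by simp
    finally have "poly (pCons a p) n \<le> 2 * (n + 2) ^ (e - 1)" using a by simp
    also have "\<dots> \<le> (n + 2) * (n + 2) ^ (e - 1)" by (intro mult_right_mono) auto
    also have "\<dots> = (n + 2) ^ e" using e by (metis One_nat_def Suc_pred add_2_eq_Suc' power_Suc zero_less_Suc less_le_trans)
    finally show ?thesis .
  qed
  then show ?case by blast
qed

lemma PSPACE_reducible:
  assumes "infinite (UNIV :: 'w set)" "L \<in> PSPACE"
  shows "L \<le>\<^sub>p SAT TYPE('w)"
proof -
  obtain k G M p where M: "turing_machine k G M"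
    and halts: "\<And>x. \<exists>t. halts_with_output M (run M k x t) [x \<in> L]"
    and space: "\<And>x t tp. tp \<in> set (snd (run M k x t)) \<Longrightarrow> snd tp \<le> poly p (length x)"
    using assms(2) unfolding PSPACE_def by blast
  define S where "S = cells k G M"
  have "finite S" unfolding S_def by (rule finite_cells)
  define r where "r = card (S \<times> S \<times> S)"
  obtain dec where dec: "bij_betw dec {..<r} (S \<times> S \<times> S)"
    using ex_bij_betw_nat_finite[of "S \<times> S \<times> S"] \<open>finite S\<close> unfolding r_def atLeast0LessThan by blast
  interpret B: space_bounded k G M 2 by standard (simp_all add: M)
  have "S \<noteq> {}"
    using B.valid_config_word[OF B.inside_init[of "[]"]] unfolding S_def valid_word_def by auto
  then have r: "0 < r" using \<open>finite S\<close> by (simp add: r_def card_gt_0_iff)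
  interpret T: savitch w r dec S adjacent "successor M" for w by standard (rule dec r)+
  obtain d0 where d0: "\<And>e n. d0 \<le> e \<Longrightarrow> poly p n \<le> (n + 2) ^ e" using poly_le_power[of p] by blast
  \<comment> \<open>\<open>d0\<close> takes care of the space bound. With
    \<open>N = (length x + 2) ^ d\<close>, the summand \<open>card S + 4\<close> ensures
    \<open>card S * (N + 3) \<le> (card S + 4) * N \<le> N * N\<close>, so that \<open>N * N\<close>
    rounds suffice for all words of \<open>N + 3\<close> cells.\<close>
  define d where "d = d0 + card S + 4"
  \<comment> \<open>Both ends of the computation are imposed in the first block: the start track is
    initial and the goal track accepting.\<close>
  define al where "al f g a \<longleftrightarrow> fst (dec a) = initial_cell k f g \<and> accepting M (snd (snd (dec a)))" for f g a
  define w where "w x = (length x + 2) ^ d + 2" for x :: "bool list"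
  define m where "m x = (length x + 2) ^ (2 * d)" for x :: "bool list"
  define row where "row x = first_row al (w x) (fst (tape_of x))" for x
  define \<Phi> where "\<Phi> x = T.formula (w x) (T.rounds (w x) (m x) (row x) T.final)" for x
  have "satisfiable TYPE('w) (\<Phi> x) \<longleftrightarrow> x \<in> L" for x
  proof -
    let ?N = "(length x + 2) ^ d"
    interpret C: space_bounded k G M "w x" by standard (simp_all add: M w_def)
    have within: "snd tp \<le> w x" if "tp \<in> set (snd (run M k x t))" for t tp
      using space[OF that] d0[of d "length x"] by (simp add: w_def d_def)
    have "d < 2 ^ d" by simp
    also have "(2::nat) ^ d \<le> ?N" by (intro power_mono) auto
    finally have "card S + 4 \<le> ?N" by (simp add: d_def)
    then have "(card S + 4) * ?N \<le> ?N * ?N" "card S \<le> ?N"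
      using mult_right_mono[of "card S + 4" ?N ?N] by (simp, linarith)
    moreover have "card S * Suc (w x) = card S * ?N + 3 * card S" by (simp add: w_def algebra_simps)
    moreover have "m x = ?N * ?N" by (simp only: m_def mult_2 power_add)
    ultimately have le: "card S * Suc (w x) \<le> Suc (m x)" by (simp add: distrib_right)
    have "card S ^ Suc (w x) \<le> (2 ^ card S) ^ Suc (w x)"
      by (intro power_mono) (simp_all add: less_imp_le)
    also have "\<dots> = 2 ^ (card S * Suc (w x))" by (simp only: power_mult)
    also have "\<dots> \<le> 2 ^ Suc (m x)" using le by (intro power_increasing) auto
    finally have card: "card (cells k G M) ^ Suc (w x) \<le> 2 ^ Suc (m x)" by (simp only: S_def)
    obtain t where t: "halts_with_output M (run M k x t) [x \<in> L]" using halts by blast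
    have "satisfiable TYPE('w) (\<Phi> x) \<longleftrightarrow> (\<exists>X Y. (\<forall>i\<le>w x. X ! i = initial_cell k (flag (w x) i) (fst (tape_of x) i) \<and>
        accepting M (Y ! i)) \<and> (X, Y) \<in> word_moves (w x) S adjacent (successor M) ^^ (2 ^ Suc (m x)))"
      unfolding \<Phi>_def row_def
      by (rule T.satisfiable_rounds[OF assms(1)])
        (auto simp: first_row_def al_def less_Suc_eq_le simp del: upt_Suc)
    also have "\<dots> \<longleftrightarrow> x \<in> L"
      using C.run_moves[OF within t card] by (simp only: S_def)
    finally show ?thesis .
  qed
  moreover have "enc_fm \<phi> \<in> SAT TYPE('w) \<longleftrightarrow> satisfiable TYPE('w) \<phi>" for \<phi>
    using inj_enc_fm unfolding SAT_def by (auto dest: injD)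
  moreover have "polytime_computable (\<lambda>x. enc_fm (\<Phi> x))"
    unfolding \<Phi>_def w_def m_def row_def by (rule polytime_rounds[OF dec r])
  ultimately show ?thesis
    unfolding polytime_reducible_def by (intro exI[of _ "\<lambda>x. enc_fm (\<Phi> x)"]) simp
qed

theorem theorem5:
  assumes "infinite (UNIV :: 'w set)"
  shows "PSPACE_hard (SAT TYPE('w))"
  unfolding PSPACE_hard_def using PSPACE_reducible[OF assms] by blast

end
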